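(* Let $X$ be a locale and let $R\rightarrowtail X\times X$ be a localic equivalence relation with open cones. Then $R_{\Uparrow_R,\Downarrow_R}\cong X\times_{X/R}X$ as sublocales of $X\times X$.
   Context: Frames and locales. A frame is a complete lattice (order $\sqsubseteq$) in which $x\wedge\bigvee y_i=\bigvee (x\wedge y_i)$; frame maps preserve finite meets and all joins. The category of locales is the opposite of the category of frames: a locale $X$ has a frame of opens $\mathcal{O}X$, and a map $f\colon X\to Y$ is a frame map $f^{-1}\colon\mathcal{O}Y\to\mathcal{O}X$. $L\otimes M$ is the coproduct of frames, generated under joins by the rectangles $x\otimes y=\iota_1(x)\wedge\iota_2(y)$ ($\iota_1,\iota_2$ the coproduct injections); $\mathcal{O}(X\times Y)=\mathcal{O}X\otimes\mathcal{O}Y$. A sublocale of $X$ is (an isomorphism class of) an extremal monomorphism $A\rightarrowtail X$, equivalently a map whose frame map is surjective; $A\subseteq B$ means the inclusion of $A$ factors through that of $B$. Relations. A localic relation on $X$ is a sublocale $r\colon R\rightarrowtail X\times X$; its source and target maps are $s=\mathrm{pr}_1\circ r$, $t=\mathrm{pr}_2\circ r\colon R\to X$. A locale map $f\colon X\to Y$ is open if $f^{-1}$ has a left adjoint $f_!$ with $f_!(U\wedge f^{-1}(V))=f_!(U)\wedge V$. $R$ has open cones if $s,t$ are open; then its induced cones are $\Uparrow_R:=t_!s^{-1}$ and $\Downarrow_R:=s_!t^{-1}\colon\mathcal{O}X\to\mathcal{O}X$. These preserve all joins and are parallel in the sense below. $\Delta$ denotes the diagonal relation $X\rightarrowtail X\times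 X$; $R^{\mathrm{op}}$ is the relation with source and target interchanged; the composite $R\circ R$ is the image sublocale of the map $(s\circ\pi_1,t\circ\pi_2)\colon R\times_X^{t,s}R\to X\times X$, with $\pi_1,\pi_2$ the projections of the pullback of $t$ (first factor) and $s$ (second factor). $R$ is an equivalence relation if $\Delta\subseteq R$, $R\circ R\subseteq R$ and $R=R^{\mathrm{op}}$. The quotient map $q\colon X\twoheadrightarrow X/R$ is the coequaliser of $s,t\colon R\to X$ in locales, and $X\times_{X/R}X$ is its kernel pair, the pullback of $q$ along itself, a sublocale of $X\times X$. Parallel pairs and induced relation. Functions $\mathsf{u},\mathsf{d}\colon L\to L$ on a frame are parallel if $\mathsf{u}(x)\wedge y\sqsubseteq\mathsf{u}(x\wedge\mathsf{d}(y))$ and $x\wedge\mathsf{d}(y)\sqsubseteq\mathsf{d}(\mathsf{u}(x)\wedge y)$ for all $x,y\in L$. Given such a join-preserving pair on $\mathcal{O}X$, let $\sim$ be the binary relation on rectangles of $\mathcal{O}X\otimes\mathcal{O}X$ with $a\otimes b\sim c\otimes d$ iff $\mathsf{u}(a)\wedge b=\mathsf{u}(c)\wedge d$ and $a\wedge\mathsf{d}(b)=c\wedge\mathsf{d}(d)$. An element $o\in\mathcal{O}X\otimes\mathcal{O}X$ is $\sim$-saturated if for all $p\sim q$ and all $w$: $p\wedge w\sqsubseteq o$ iff $q\wedge w\sqsubseteq o$. $R_{\mathsf{u},\mathsf{d}}\rightarrowtail X\times X$ is the sublocale whose frame is the set of $\sim$-saturated elements, with frame map $\mu_\sim(o)=$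 the least $\sim$-saturated element above $o$; equivalently, the quotient of $\mathcal{O}X\otimes\mathcal{O}X$ by the frame congruence generated by $\sim$. *)

theory Defs
  imports "HOL-Algebra.Galois_Connection"
begin

text \<open>A locale \<open>X\<close> is represented by its frame of opens, a map of locales
  \<open>f : X \<rightarrow> Y\<close> by the frame map from the opens of \<open>Y\<close> to the opens of \<open>X\<close>. All
  constructions below are therefore written in the direction of frame maps.\<close>

locale frame = complete_lattice L for L (structure) +
  assumes inf_Sup_distrib:
    "\<lbrakk>x \<in> carrier L; A \<subseteq> carrier L\<rbrakk> \<Longrightarrow> x \<sqinter> (\<Squnion> A) = \<Squnion> ((\<lambda>y. x \<sqinter> y) ` A)"

definition frame_hom :: "'a gorder \<Rightarrow> 'b gorder \<Rightarrow> ('a \<Rightarrow> 'b) \<Rightarrow> bool" where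
  "frame_hom L M f \<longleftrightarrow>
     f \<in> carrier L \<rightarrow> carrier M \<and>
     f \<top>\<^bsub>L\<^esub> = \<top>\<^bsub>M\<^esub> \<and>
     (\<forall>x\<in>carrier L. \<forall>y\<in>carrier L. f (x \<sqinter>\<^bsub>L\<^esub> y) = f x \<sqinter>\<^bsub>M\<^esub> f y) \<and>
     (\<forall>A. A \<subseteq> carrier L \<longrightarrow> f (\<Squnion>\<^bsub>L\<^esub> A) = \<Squnion>\<^bsub>M\<^esub> (f ` A))"


section \<open>Coproducts of frames\<close>

text \<open>The coproduct is realised by the sets of pairs (thought of as sets of
  rectangles) that are closed downwards and under joins in each variable separately.
  The joins include the empty ones, so every such set contains
  \<open>(\<bottom>, b)\<close> and \<open>(a, \<bottom>)\<close>.\<close>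

definition cp_ideal :: "'a gorder \<Rightarrow> 'b gorder \<Rightarrow> ('a \<times> 'b) set \<Rightarrow> bool" where
  "cp_ideal L M U \<longleftrightarrow>
     U \<subseteq> carrier L \<times> carrier M \<and>
     (\<forall>a b a' b'. (a, b) \<in> U \<and> a' \<in> carrier L \<and> b' \<in> carrier M \<and> a' \<sqsubseteq>\<^bsub>L\<^esub> a \<and> b' \<sqsubseteq>\<^bsub>M\<^esub> b
        \<longrightarrow> (a', b') \<in> U) \<and>
     (\<forall>A b. A \<subseteq> carrier L \<and> b \<in> carrier M \<and> (\<forall>a\<in>A. (a, b) \<in> U) \<longrightarrow> (\<Squnion>\<^bsub>L\<^esub> A, b) \<in> U) \<and>
     (\<forall>a B. a \<in> carrier L \<and> B \<subseteq> carrier M \<and> (\<forall>b\<in>B. (a, b) \<in> U) \<longrightarrow> (a, \<Squnion>\<^bsub>M\<^esub> B) \<in> U)"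

definition tensor :: "'a gorder \<Rightarrow> 'b gorder \<Rightarrow> ('a \<times> 'b) set gorder" where
  "tensor L M = \<lparr>carrier = {U. cp_ideal L M U}, eq = (=), le = (\<subseteq>)\<rparr>"

definition cp_gen :: "'a gorder \<Rightarrow> 'b gorder \<Rightarrow> 'a \<Rightarrow> 'b \<Rightarrow> ('a \<times> 'b) set" where
  "cp_gen L M a b = \<Inter> {U. cp_ideal L M U \<and> (a, b) \<in> U}"

definition inj1 :: "'a gorder \<Rightarrow> 'b gorder \<Rightarrow> 'a \<Rightarrow> ('a \<times> 'b) set" where
  "inj1 L M a = cp_gen L M a \<top>\<^bsub>M\<^esub>"

definition inj2 :: "'a gorder \<Rightarrow> 'b gorder \<Rightarrow> 'b \<Rightarrow> ('a \<times> 'b) set" where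
  "inj2 L M b = cp_gen L M \<top>\<^bsub>L\<^esub> b"

definition rect :: "'a gorder \<Rightarrow> 'b gorder \<Rightarrow> 'a \<Rightarrow> 'b \<Rightarrow> ('a \<times> 'b) set" where
  "rect L M a b = inj1 L M a \<sqinter>\<^bsub>tensor L M\<^esub> inj2 L M b"

text \<open>For frame maps \<open>f : L \<rightarrow> Z\<close> and \<open>g : M \<rightarrow> Z\<close>, the induced frame map
  \<open>L \<otimes> M \<rightarrow> Z\<close>; it represents the map \<open>(f, g)\<close> into the product locale.\<close>

definition copair ::
    "'z gorder \<Rightarrow> ('a \<Rightarrow> 'z) \<Rightarrow> ('b \<Rightarrow> 'z) \<Rightarrow> ('a \<times> 'b) set \<Rightarrow> 'z" where
  "copair Z f g U = \<Squnion>\<^bsub>Z\<^esub> ((\<lambda>(a, b). f a \<sqinter>\<^bsub>Z\<^esub> g b) ` U)"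


section \<open>Sublocales\<close>

text \<open>A sublocale of the locale with frame \<open>N\<close> is given by its frame and the
  surjective frame map out of \<open>N\<close>.\<close>

type_synonym ('n, 'r) subloc = "'r gorder \<times> ('n \<Rightarrow> 'r)"

definition is_sublocale :: "'n gorder \<Rightarrow> ('n, 'r) subloc \<Rightarrow> bool" where
  "is_sublocale N A \<longleftrightarrow>
     frame N \<and> frame (fst A) \<and> frame_hom N (fst A) (snd A) \<and>
     snd A ` carrier N = carrier (fst A)"

definition subloc_le :: "'n gorder \<Rightarrow> ('n, 'r) subloc \<Rightarrow> ('n, 's) subloc \<Rightarrow> bool" where
  "subloc_le N A B \<longleftrightarrow>
     (\<exists>h. frame_hom (fst B) (fst A) h \<and> (\<forall>w\<in>carrier N. h (snd B w) = snd A w))"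

definition subloc_iso :: "'n gorder \<Rightarrow> ('n, 'r) subloc \<Rightarrow> ('n, 's) subloc \<Rightarrow> bool" where
  "subloc_iso N A B \<longleftrightarrow>
     (\<exists>h. frame_hom (fst B) (fst A) h \<and> bij_betw h (carrier (fst B)) (carrier (fst A)) \<and>
          (\<forall>w\<in>carrier N. h (snd B w) = snd A w))"

text \<open>The image of a map \<open>f : Z \<rightarrow> Y\<close>, where \<open>N\<close> is the frame of \<open>Y\<close>: the frame map
  factors through its set-theoretic image, a subframe of \<open>Z\<close>.\<close>

definition image_subloc :: "'n gorder \<Rightarrow> 'z gorder \<Rightarrow> ('n \<Rightarrow> 'z) \<Rightarrow> ('n, 'z) subloc" where
  "image_subloc N Z f = (Z\<lparr>carrier := f ` carrier N\<rparr>, f)"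

text \<open>The quotient of a frame by the congruence generated by a binary relation.\<close>

definition saturated :: "'n gorder \<Rightarrow> ('n \<times> 'n) set \<Rightarrow> 'n set" where
  "saturated N \<rho> = {z \<in> carrier N.
     \<forall>(p, q)\<in>\<rho>. \<forall>w\<in>carrier N. p \<sqinter>\<^bsub>N\<^esub> w \<sqsubseteq>\<^bsub>N\<^esub> z \<longleftrightarrow> q \<sqinter>\<^bsub>N\<^esub> w \<sqsubseteq>\<^bsub>N\<^esub> z}"

definition saturation :: "'n gorder \<Rightarrow> ('n \<times> 'n) set \<Rightarrow> 'n \<Rightarrow> 'n" where
  "saturation N \<rho> z = (THE c. least N c {y \<in> saturated N \<rho>. z \<sqsubseteq>\<^bsub>N\<^esub> y})"

definition quot_subloc :: "'n gorder \<Rightarrow> ('n \<times> 'n) set \<Rightarrow> ('n, 'n) subloc" where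
  "quot_subloc N \<rho> = (N\<lparr>carrier := saturated N \<rho>\<rparr>, saturation N \<rho>)"


section \<open>Pullbacks and coequalisers of locales\<close>

text \<open>The pullback of \<open>f : A \<rightarrow> K\<close> and \<open>g : B \<rightarrow> K\<close>, a pushout of frames.\<close>

definition pullback ::
    "'k gorder \<Rightarrow> 'a gorder \<Rightarrow> 'b gorder \<Rightarrow> ('k \<Rightarrow> 'a) \<Rightarrow> ('k \<Rightarrow> 'b)
      \<Rightarrow> (('a \<times> 'b) set, ('a \<times> 'b) set) subloc" where
  "pullback K A B f g =
     quot_subloc (tensor A B) {(inj1 A B (f u), inj2 A B (g u)) | u. u \<in> carrier K}"

definition pullback_pr1 ::
    "'k gorder \<Rightarrow> 'a gorder \<Rightarrow> 'b gorder \<Rightarrow> ('k \<Rightarrow> 'a) \<Rightarrow> ('k \<Rightarrow> 'b) \<Rightarrow> 'a \<Rightarrow> ('a \<times> 'b) set" where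
  "pullback_pr1 K A B f g = snd (pullback K A B f g) \<circ> inj1 A B"

definition pullback_pr2 ::
    "'k gorder \<Rightarrow> 'a gorder \<Rightarrow> 'b gorder \<Rightarrow> ('k \<Rightarrow> 'a) \<Rightarrow> ('k \<Rightarrow> 'b) \<Rightarrow> 'b \<Rightarrow> ('a \<times> 'b) set" where
  "pullback_pr2 K A B f g = snd (pullback K A B f g) \<circ> inj2 A B"

text \<open>The coequaliser of \<open>f, g : Z \<rightarrow> X\<close> is the equaliser of the frame maps, with the
  inclusion of this subframe as frame map of the quotient map.\<close>

definition coequaliser :: "'a gorder \<Rightarrow> ('a \<Rightarrow> 'z) \<Rightarrow> ('a \<Rightarrow> 'z) \<Rightarrow> 'a gorder" where
  "coequaliser X f g = X\<lparr>carrier := {u \<in> carrier X. f u = g u}\<rparr>"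

definition coequaliser_map :: "'a \<Rightarrow> 'a" where
  "coequaliser_map = (\<lambda>u. u)"


section \<open>Localic relations\<close>

type_synonym ('a, 'r) localic_relation = "(('a \<times> 'a) set, 'r) subloc"

definition is_localic_relation :: "'a gorder \<Rightarrow> ('a, 'r) localic_relation \<Rightarrow> bool" where
  "is_localic_relation X R \<longleftrightarrow> frame X \<and> is_sublocale (tensor X X) R"

text \<open>The frame maps of the source and target maps.\<close>

definition source :: "'a gorder \<Rightarrow> ('a, 'r) localic_relation \<Rightarrow> 'a \<Rightarrow> 'r" where
  "source X R = snd R \<circ> inj1 X X"

definition target :: "'a gorder \<Rightarrow> ('a, 'r) localic_relation \<Rightarrow> 'a \<Rightarrow> 'r" where
  "target X R = snd R \<circ> inj2 X X"

definition diagonal :: "'a gorder \<Rightarrow> ('a, 'a) localic_relation" where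
  "diagonal X = (X, copair X (\<lambda>u. u) (\<lambda>u. u))"

definition opposite :: "'a gorder \<Rightarrow> ('a, 'r) localic_relation \<Rightarrow> ('a, 'r) localic_relation" where
  "opposite X R = (fst R, copair (fst R) (target X R) (source X R))"

definition self_composite ::
    "'a gorder \<Rightarrow> ('a, 'r) localic_relation \<Rightarrow> ('a, ('r \<times> 'r) set) localic_relation" where
  "self_composite X R =
     (let P = fst (pullback X (fst R) (fst R) (target X R) (source X R));
          p1 = pullback_pr1 X (fst R) (fst R) (target X R) (source X R);
          p2 = pullback_pr2 X (fst R) (fst R) (target X R) (source X R)
      in image_subloc (tensor X X) P (copair P (p1 \<circ> source X R) (p2 \<circ> target X R)))"

definition is_equivalence_relation :: "'a gorder \<Rightarrow> ('a, 'r) localic_relation \<Rightarrow> bool" where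
  "is_equivalence_relation X R \<longleftrightarrow>
     is_localic_relation X R \<and>
     subloc_le (tensor X X) (diagonal X) R \<and>
     subloc_le (tensor X X) (self_composite X R) R \<and>
     subloc_iso (tensor X X) R (opposite X R)"


section \<open>Open maps and cones\<close>

definition is_left_adjoint :: "'a gorder \<Rightarrow> 'b gorder \<Rightarrow> ('a \<Rightarrow> 'b) \<Rightarrow> ('b \<Rightarrow> 'a) \<Rightarrow> bool" where
  "is_left_adjoint L M f g \<longleftrightarrow>
     galois_connection \<lparr>orderA = M, orderB = L, lower = g, upper = f\<rparr>"

definition open_map :: "'a gorder \<Rightarrow> 'b gorder \<Rightarrow> ('a \<Rightarrow> 'b) \<Rightarrow> bool" where
  "open_map L M f \<longleftrightarrow>
     frame_hom L M f \<and>
     (\<exists>g. is_left_adjoint L M f g \<and>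
          (\<forall>U\<in>carrier M. \<forall>V\<in>carrier L. g (U \<sqinter>\<^bsub>M\<^esub> f V) = g U \<sqinter>\<^bsub>L\<^esub> V))"

text \<open>Left adjoints are unique on the carrier, so the choice does not matter there.\<close>

definition left_adjoint :: "'a gorder \<Rightarrow> 'b gorder \<Rightarrow> ('a \<Rightarrow> 'b) \<Rightarrow> 'b \<Rightarrow> 'a" where
  "left_adjoint L M f = (SOME g. is_left_adjoint L M f g)"

definition has_open_cones :: "'a gorder \<Rightarrow> ('a, 'r) localic_relation \<Rightarrow> bool" where
  "has_open_cones X R \<longleftrightarrow>
     open_map X (fst R) (source X R) \<and> open_map X (fst R) (target X R)"

definition up_cone :: "'a gorder \<Rightarrow> ('a, 'r) localic_relation \<Rightarrow> 'a \<Rightarrow> 'a" where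
  "up_cone X R = left_adjoint X (fst R) (target X R) \<circ> source X R"

definition down_cone :: "'a gorder \<Rightarrow> ('a, 'r) localic_relation \<Rightarrow> 'a \<Rightarrow> 'a" where
  "down_cone X R = left_adjoint X (fst R) (source X R) \<circ> target X R"


section \<open>The relation induced by a pair of maps, and the kernel pair\<close>

definition rect_rel ::
    "'a gorder \<Rightarrow> ('a \<Rightarrow> 'a) \<Rightarrow> ('a \<Rightarrow> 'a) \<Rightarrow> (('a \<times> 'a) set \<times> ('a \<times> 'a) set) set" where
  "rect_rel X u d = {(rect X X a b, rect X X a' b') | a b a' b'.
     a \<in> carrier X \<and> b \<in> carrier X \<and> a' \<in> carrier X \<and> b' \<in> carrier X \<and>
     u a \<sqinter>\<^bsub>X\<^esub> b = u a' \<sqinter>\<^bsub>X\<^esub> b' \<and> a \<sqinter>\<^bsub>X\<^esub> d b = a' \<sqinter>\<^bsub>X\<^esub> d b'}"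

definition induced_relation ::
    "'a gorder \<Rightarrow> ('a \<Rightarrow> 'a) \<Rightarrow> ('a \<Rightarrow> 'a) \<Rightarrow> ('a, ('a \<times> 'a) set) localic_relation" where
  "induced_relation X u d = quot_subloc (tensor X X) (rect_rel X u d)"

text \<open>Here \<open>q : Q \<rightarrow> X\<close> is the frame map of a locale map from \<open>X\<close> to the locale with
  frame \<open>Q\<close>.\<close>

definition kernel_pair :: "'q gorder \<Rightarrow> 'a gorder \<Rightarrow> ('q \<Rightarrow> 'a) \<Rightarrow> ('a, ('a \<times> 'a) set) localic_relation" where
  "kernel_pair Q X q =
     (let P = fst (pullback Q X X q q)
      in (P, copair P (pullback_pr1 Q X X q q) (pullback_pr2 Q X X q q)))"

definition quotient_locale :: "'a gorder \<Rightarrow> ('a, 'r) localic_relation \<Rightarrow> 'a gorder" where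
  "quotient_locale X R = coequaliser X (source X R) (target X R)"

end

theory Submission
  imports Defs
begin

text \<open>Write \<open>s, t\<close> for the source and target maps of \<open>R\<close> and \<open>U\<close> for the up cone. By symmetry
  \<open>U\<close> is also the down cone, and \<open>U a \<sqsubseteq> b\<close> iff \<open>s a \<sqsubseteq> t b\<close>. Reflexivity gives \<open>a \<sqsubseteq> U a\<close>, and
  transitivity together with openness of \<open>t\<close> gives \<open>s (U a) = t (U a)\<close>: the opens of \<open>X/R\<close> are
  the fixed points of \<open>U\<close>. Modulo the congruence of the kernel pair, opens of \<open>X/R\<close> can be moved
  between the two factors of a rectangle. Hence there \<open>a \<otimes> b\<close> equals
  \<open>(a \<sqinter> U b) \<otimes> (U a \<sqinter> b)\<close>, which depends only on the two elements that define the relation on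
  rectangles. Conversely, that relation contains \<open>(u \<otimes> \<top>, \<top> \<otimes> u)\<close> for each fixed point
  \<open>u\<close>. So both quotients have the same saturated elements.\<close>


section \<open>Frames and Heyting implication\<close>

text \<open>The library criterion asks for a greatest element and for infima of nonempty sets. Every
  element is a lower bound of the empty set, so the infimum of \<open>{}\<close> supplies the
  greatest element.\<close>

lemma (in partial_order) complete_latticeI_inf:
  assumes inf: "\<And>A. A \<subseteq> carrier L \<Longrightarrow> \<exists>i. greatest L i (Lower L A)"
  shows "complete_lattice L"
proof -
  have "\<exists>g. greatest L g (carrier L)"
    using inf[of "{}"] by simp
  then have "weak_complete_lattice L"
    using inf by (intro weak_complete_lattice_criterion1) auto
  then show ?thesis
    using partial_order_axioms by (simp add: complete_lattice_def complete_lattice_axioms_def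
        weak_complete_lattice_def weak_complete_lattice_axioms_def)
qed

context complete_lattice
begin

lemma le_meet_iff:
  assumes "x \<in> carrier L" "y \<in> carrier L" "z \<in> carrier L"
  shows "z \<sqsubseteq> x \<sqinter> y \<longleftrightarrow> z \<sqsubseteq> x \<and> z \<sqsubseteq> y"
proof
  assume "z \<sqsubseteq> x \<sqinter> y"
  then show "z \<sqsubseteq> x \<and> z \<sqsubseteq> y"
    using assms le_trans[of z "x \<sqinter> y"] meet_left[of x y] meet_right[of x y] by simp
qed (use assms in \<open>simp add: meet_le\<close>)

lemma le_inf_iff:
  assumes "A \<subseteq> carrier L" "z \<in> carrier L"
  shows "z \<sqsubseteq> \<Sqinter>A \<longleftrightarrow> (\<forall>x\<in>A. z \<sqsubseteq> x)"
proof
  assume "z \<sqsubseteq> \<Sqinter>A"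
  then show "\<forall>x\<in>A. z \<sqsubseteq> x"
    using assms inf_lower[OF assms(1)] by (blast intro: le_trans[of z "\<Sqinter>A"] inf_closed)
qed (use assms in \<open>simp add: inf_greatest\<close>)

lemma sup_le_iff:
  assumes "A \<subseteq> carrier L" "z \<in> carrier L"
  shows "\<Squnion>A \<sqsubseteq> z \<longleftrightarrow> (\<forall>x\<in>A. x \<sqsubseteq> z)"
proof
  assume "\<Squnion>A \<sqsubseteq> z"
  then show "\<forall>x\<in>A. x \<sqsubseteq> z"
    using assms sup_upper[OF assms(1)] by (blast intro: le_trans[of _ "\<Squnion>A" z] sup_closed)
qed (use assms in \<open>simp add: sup_least\<close>)

lemma meet_eq_left:
  assumes "x \<in> carrier L" "y \<in> carrier L" "x \<sqsubseteq> y"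
  shows "x \<sqinter> y = x"
  using assms meet_left[of x y] by (intro le_antisym) (simp_all add: le_meet_iff)

lemma meet_mono:
  assumes "x \<in> carrier L" "y \<in> carrier L" "x' \<in> carrier L" "y' \<in> carrier L"
    and "x \<sqsubseteq> x'" "y \<sqsubseteq> y'"
  shows "x \<sqinter> y \<sqsubseteq> x' \<sqinter> y'"
proof -
  have "x \<sqinter> y \<sqsubseteq> x'"
    using assms by (intro le_trans[OF meet_left[of x y], of x']) simp_all
  moreover have "x \<sqinter> y \<sqsubseteq> y'"
    using assms by (intro le_trans[OF meet_right[of x y], of y']) simp_all
  ultimately show ?thesis
    using assms by (simp add: le_meet_iff)
qed

lemma meet_top:
  assumes "x \<in> carrier L"
  shows "x \<sqinter> \<top> = x" "\<top> \<sqinter> x = x"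
  using assms meet_eq_left[OF assms top_closed] meet_comm[of L x "\<top>"] by simp_all

text \<open>Taking \<open>z\<close> to be \<open>x\<close> and then \<open>y\<close> reduces this to
  antisymmetry. It suits elements given by a universal property (joins, saturations, left adjoints),
  where only the condition for lying below \<open>z\<close> is explicit.\<close>

lemma eq_if_same_upper_bounds:
  assumes "x \<in> carrier L" "y \<in> carrier L"
    and "\<And>z. z \<in> carrier L \<Longrightarrow> x \<sqsubseteq> z \<longleftrightarrow> y \<sqsubseteq> z"
  shows "x = y"
  using assms(3)[OF assms(1)] assms(3)[OF assms(2)] assms(1,2) by (simp add: le_antisym)

lemma sup_eqI:
  assumes "A \<subseteq> carrier L" "x \<in> carrier L"
    and "\<And>z. z \<in> carrier L \<Longrightarrow> x \<sqsubseteq> z \<longleftrightarrow> (\<forall>a\<in>A. a \<sqsubseteq> z)"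
  shows "\<Squnion>A = x"
  using assms by (intro eq_if_same_upper_bounds) (auto simp: sup_le_iff)

text \<open>A right adjoint to \<open>x \<sqinter> _\<close> forces this map to preserve joins. Both
  the quotients and the coproducts below are shown to be frames in this way, because their
  implications are easier to describe than their joins.\<close>

lemma frame_if_implication:
  assumes imp: "\<And>x y. \<lbrakk>x \<in> carrier L; y \<in> carrier L\<rbrakk> \<Longrightarrow>
    \<exists>i\<in>carrier L. \<forall>z\<in>carrier L. x \<sqinter> z \<sqsubseteq> y \<longleftrightarrow> z \<sqsubseteq> i"
  shows "frame L"
proof unfold_locales
  fix x A
  assume x: "x \<in> carrier L" and A: "A \<subseteq> carrier L"
  let ?B = "(\<lambda>y. x \<sqinter> y) ` A"
  have B: "?B \<subseteq> carrier L"
    using x A by auto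
  show "x \<sqinter> \<Squnion>A = \<Squnion>?B"
  proof (rule eq_if_same_upper_bounds)
    fix z assume z: "z \<in> carrier L"
    obtain i where i: "i \<in> carrier L" "\<And>v. v \<in> carrier L \<Longrightarrow> x \<sqinter> v \<sqsubseteq> z \<longleftrightarrow> v \<sqsubseteq> i"
      using imp[OF x z] by blast
    \<comment> \<open>Passing to \<open>i\<close> removes the meet with \<open>x\<close>, so the
      join can be tested on the members of \<open>A\<close>; passing back restores the meet on each
      member.\<close>
    have "x \<sqinter> \<Squnion>A \<sqsubseteq> z \<longleftrightarrow> (\<forall>a\<in>A. a \<sqsubseteq> i)"
      using i A by (simp add: sup_le_iff)
    also have "\<dots> \<longleftrightarrow> \<Squnion>?B \<sqsubseteq> z"
      using i(2) A B z by (simp add: sup_le_iff subset_iff)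
    finally show "x \<sqinter> \<Squnion>A \<sqsubseteq> z \<longleftrightarrow> \<Squnion>?B \<sqsubseteq> z" .
  qed (use x A B in auto)
qed

end

text \<open>By the frame law, the join of all \<open>z\<close> with
  \<open>x \<sqinter> z \<sqsubseteq> y\<close> again satisfies this inequality, hence is the
  largest such \<open>z\<close>.\<close>

lemma (in frame) ex_implication:
  assumes x: "x \<in> carrier L" and y: "y \<in> carrier L"
  shows "\<exists>i\<in>carrier L. \<forall>z\<in>carrier L. x \<sqinter> z \<sqsubseteq> y \<longleftrightarrow> z \<sqsubseteq> i"
proof -
  let ?A = "{z \<in> carrier L. x \<sqinter> z \<sqsubseteq> y}"
  have A: "?A \<subseteq> carrier L" by auto
  have "x \<sqinter> \<Squnion>?A \<sqsubseteq> y"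
    using x y A by (subst inf_Sup_distrib) (auto intro!: sup_least)
  then have "x \<sqinter> z \<sqsubseteq> y" if "z \<in> carrier L" "z \<sqsubseteq> \<Squnion>?A" for z
    using that x y sup_closed[OF A] meet_mono[of x z x "\<Squnion>?A"]
      le_trans[of "x \<sqinter> z" "x \<sqinter> \<Squnion>?A" y] by simp
  moreover have "z \<sqsubseteq> \<Squnion>?A" if "z \<in> carrier L" "x \<sqinter> z \<sqsubseteq> y" for z
    using that A by (intro sup_upper) auto
  ultimately have "\<forall>z\<in>carrier L. x \<sqinter> z \<sqsubseteq> y \<longleftrightarrow> z \<sqsubseteq> \<Squnion>?A"
    by blast
  then show ?thesis
    using sup_closed[OF A] by blast
qed

section \<open>Frame maps and join-preserving maps\<close>

lemma frame_hom_closed: "frame_hom L M f \<Longrightarrow> x \<in> carrier L \<Longrightarrow> f x \<in> carrier M"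
  by (auto simp: frame_hom_def)

lemma frame_hom_top: "frame_hom L M f \<Longrightarrow> f \<top>\<^bsub>L\<^esub> = \<top>\<^bsub>M\<^esub>"
  by (simp add: frame_hom_def)

lemma frame_hom_meet:
  "\<lbrakk>frame_hom L M f; x \<in> carrier L; y \<in> carrier L\<rbrakk>
    \<Longrightarrow> f (x \<sqinter>\<^bsub>L\<^esub> y) = f x \<sqinter>\<^bsub>M\<^esub> f y"
  by (simp add: frame_hom_def)

lemma frame_hom_mono:
  assumes "frame L" "frame M" and f: "frame_hom L M f"
    and x: "x \<in> carrier L" and y: "y \<in> carrier L" and le: "x \<sqsubseteq>\<^bsub>L\<^esub> y"
  shows "f x \<sqsubseteq>\<^bsub>M\<^esub> f y"
proof -
  interpret L: frame L by fact
  interpret M: frame M by fact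
  have "f x = f x \<sqinter>\<^bsub>M\<^esub> f y"
    using frame_hom_meet[OF f x y] L.meet_eq_left[OF x y le] by simp
  then show ?thesis
    using M.meet_right[OF frame_hom_closed[OF f x] frame_hom_closed[OF f y]] by simp
qed

text \<open>The frame map of the kernel pair is known to agree with a saturation map only on the
  carrier; this transfers the homomorphism property across such an agreement.\<close>

lemma frame_hom_cong:
  assumes "frame L" and f: "frame_hom L M f" and eq: "\<And>x. x \<in> carrier L \<Longrightarrow> g x = f x"
  shows "frame_hom L M g"
proof -
  interpret frame L by fact
  have "g ` A = f ` A" if "A \<subseteq> carrier L" for A
    using that eq by (intro image_cong) auto
  then show ?thesis
    using f eq unfolding frame_hom_def by (auto simp: Pi_iff)
qed

text \<open>Frame maps are too narrow here: the left adjoint \<open>t_!\<close> of an open map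
  preserves joins but in general not finite meets, and it has to be composed with \<open>s\<close>
  in the transitivity argument.\<close>

definition sup_hom :: "'a gorder \<Rightarrow> 'b gorder \<Rightarrow> ('a \<Rightarrow> 'b) \<Rightarrow> bool" where
  "sup_hom L M f \<longleftrightarrow>
     f \<in> carrier L \<rightarrow> carrier M \<and> (\<forall>A. A \<subseteq> carrier L \<longrightarrow> f (\<Squnion>\<^bsub>L\<^esub> A) = \<Squnion>\<^bsub>M\<^esub> (f ` A))"

lemma sup_hom_closed: "sup_hom L M f \<Longrightarrow> x \<in> carrier L \<Longrightarrow> f x \<in> carrier M"
  by (auto simp: sup_hom_def)

lemma sup_hom_sup: "sup_hom L M f \<Longrightarrow> A \<subseteq> carrier L \<Longrightarrow> f (\<Squnion>\<^bsub>L\<^esub> A) = \<Squnion>\<^bsub>M\<^esub> (f ` A)"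
  by (simp add: sup_hom_def)

lemma frame_hom_sup_hom: "frame_hom L M f \<Longrightarrow> sup_hom L M f"
  unfolding frame_hom_def sup_hom_def by blast

lemma sup_hom_comp:
  assumes "sup_hom K L f" "sup_hom L M g"
  shows "sup_hom K M (g \<circ> f)"
  unfolding sup_hom_def
proof (intro conjI allI impI)
  show "g \<circ> f \<in> carrier K \<rightarrow> carrier M"
    using assms unfolding sup_hom_def by auto
  fix A assume A: "A \<subseteq> carrier K"
  then have "f ` A \<subseteq> carrier L"
    using assms unfolding sup_hom_def by auto
  then show "(g \<circ> f) (\<Squnion>\<^bsub>K\<^esub> A) = \<Squnion>\<^bsub>M\<^esub> ((g \<circ> f) ` A)"
    using A assms unfolding sup_hom_def by (simp add: image_comp)
qed

lemma sup_hom_mono: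
  assumes "complete_lattice L" "complete_lattice M" "sup_hom L M f"
    and "x \<in> carrier L" "y \<in> carrier L" "x \<sqsubseteq>\<^bsub>L\<^esub> y"
  shows "f x \<sqsubseteq>\<^bsub>M\<^esub> f y"
proof -
  interpret L: complete_lattice L by fact
  interpret M: complete_lattice M by fact
  have xy: "{x, y} \<subseteq> carrier L" "f ` {x, y} \<subseteq> carrier M"
    using assms unfolding sup_hom_def by auto
  have "\<Squnion>\<^bsub>L\<^esub>{x, y} = y"
    using assms by (intro L.sup_eqI) (auto intro: L.le_trans)
  then have "f y = \<Squnion>\<^bsub>M\<^esub>(f ` {x, y})"
    using sup_hom_sup[OF assms(3) xy(1)] by simp
  moreover have "f x \<sqsubseteq>\<^bsub>M\<^esub> \<Squnion>\<^bsub>M\<^esub>(f ` {x, y})"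
    using xy(2) by (rule M.sup_upper) simp
  ultimately show ?thesis by simp
qed


section \<open>Quotients of frames\<close>

locale frame_quotient = frame N for N :: "'a gorder" (structure) +
  fixes \<rho> :: "('a \<times> 'a) set"
  assumes rel_closed: "\<rho> \<subseteq> carrier N \<times> carrier N"
begin

text \<open>Only the carrier changes, so the order is that of \<open>N\<close>. Infima of saturated
  elements can be taken in \<open>N\<close>, whereas joins have to be saturated again.\<close>

abbreviation Q :: "'a gorder" where
  "Q \<equiv> N\<lparr>carrier := saturated N \<rho>\<rparr>"

lemma saturated_closed: "saturated N \<rho> \<subseteq> carrier N"
  unfolding saturated_def by auto

lemma saturatedD:
  assumes "z \<in> saturated N \<rho>" "(p, q) \<in> \<rho>" "w \<in> carrier N"
  shows "p \<sqinter> w \<sqsubseteq> z \<longleftrightarrow> q \<sqinter> w \<sqsubseteq> z"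
  using assms unfolding saturated_def by blast

text \<open>Lying below an infimum is a conjunction of conditions, one for each member, and each of
  them is invariant under \<open>\<rho>\<close>.\<close>

lemma inf_saturated:
  assumes A: "A \<subseteq> saturated N \<rho>"
  shows "\<Sqinter>A \<in> saturated N \<rho>"
proof -
  have AN: "A \<subseteq> carrier N"
    using A saturated_closed by blast
  have "p \<sqinter> w \<sqsubseteq> \<Sqinter>A \<longleftrightarrow> q \<sqinter> w \<sqsubseteq> \<Sqinter>A"
    if pq: "(p, q) \<in> \<rho>" and w: "w \<in> carrier N" for p q w
  proof -
    have "p \<in> carrier N" "q \<in> carrier N"
      using pq rel_closed by auto
    then show ?thesis
      using AN A w saturatedD[OF _ pq w] by (simp add: le_inf_iff subset_iff)
  qed
  then show ?thesis
    using AN unfolding saturated_def by auto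
qed

text \<open>The side element \<open>w\<close> in the definition of saturation absorbs
  \<open>v\<close>: the elements \<open>v \<sqinter> (r \<sqinter> w)\<close> and
  \<open>r \<sqinter> (v \<sqinter> w)\<close> are equal. Together with closure under infima this is
  what makes the saturated elements the fixed points of a nucleus.\<close>

lemma implication_saturated:
  assumes z: "z \<in> saturated N \<rho>" and v: "v \<in> carrier N" and i: "i \<in> carrier N"
    and imp: "\<And>u. u \<in> carrier N \<Longrightarrow> v \<sqinter> u \<sqsubseteq> z \<longleftrightarrow> u \<sqsubseteq> i"
  shows "i \<in> saturated N \<rho>"
proof -
  have "p \<sqinter> w \<sqsubseteq> i \<longleftrightarrow> q \<sqinter> w \<sqsubseteq> i"
    if pq: "(p, q) \<in> \<rho>" and w: "w \<in> carrier N" for p q w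
  proof -
    have pqc: "p \<in> carrier N" "q \<in> carrier N"
      using pq rel_closed by auto
    have swap: "r \<sqinter> w \<sqsubseteq> i \<longleftrightarrow> r \<sqinter> (v \<sqinter> w) \<sqsubseteq> z" if r: "r \<in> carrier N" for r
    proof -
      have "v \<sqinter> (r \<sqinter> w) = r \<sqinter> (v \<sqinter> w)"
        using r v w by (metis meet_assoc meet_comm)
      then show ?thesis
        using imp[of "r \<sqinter> w"] r w by simp
    qed
    show ?thesis
      using swap pqc saturatedD[OF z pq, of "v \<sqinter> w"] v w by simp
  qed
  then show ?thesis
    using i unfolding saturated_def by auto
qed

lemma ex_saturated_implication:
  assumes "v \<in> carrier N" "z \<in> saturated N \<rho>"
  shows "\<exists>i\<in>saturated N \<rho>. \<forall>u\<in>carrier N. v \<sqinter> u \<sqsubseteq> z \<longleftrightarrow> u \<sqsubseteq> i"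
proof -
  have "z \<in> carrier N"
    using assms saturated_closed by blast
  then obtain i where i: "i \<in> carrier N" "\<forall>u\<in>carrier N. v \<sqinter> u \<sqsubseteq> z \<longleftrightarrow> u \<sqsubseteq> i"
    using ex_implication[of v z] assms by blast
  then have "i \<in> saturated N \<rho>"
    using assms by (intro implication_saturated[of z v i]) simp_all
  with i show ?thesis by blast
qed

text \<open>The infimum of the saturated elements above \<open>z\<close> is itself saturated, so the
  definite description in \<open>saturation\<close> denotes it.\<close>

lemma saturation_least:
  assumes z: "z \<in> carrier N"
  shows "least N (saturation N \<rho> z) {y \<in> saturated N \<rho>. z \<sqsubseteq> y}"
proof -
  let ?A = "{y \<in> saturated N \<rho>. z \<sqsubseteq> y}"
  have A: "?A \<subseteq> carrier N" using saturated_closed by auto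
  have "\<Sqinter>?A \<in> saturated N \<rho>"
    by (rule inf_saturated) blast
  moreover have "z \<sqsubseteq> \<Sqinter>?A"
    using A z by (simp add: le_inf_iff)
  ultimately have least: "least N (\<Sqinter>?A) ?A"
    using A inf_lower[OF A] by (simp add: least_def)
  show ?thesis
    unfolding saturation_def by (rule theI[where P = "\<lambda>c. least N c ?A", OF least least_unique[OF _ least]])
qed

lemma saturation_saturated: "z \<in> carrier N \<Longrightarrow> saturation N \<rho> z \<in> saturated N \<rho>"
  using saturation_least unfolding least_def by blast

lemma saturation_closed: "z \<in> carrier N \<Longrightarrow> saturation N \<rho> z \<in> carrier N"
  using saturation_saturated saturated_closed by blast

lemma saturation_upper: "z \<in> carrier N \<Longrightarrow> z \<sqsubseteq> saturation N \<rho> z"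
  using saturation_least unfolding least_def by blast

lemma saturation_le_iff:
  assumes z: "z \<in> carrier N" and y: "y \<in> saturated N \<rho>"
  shows "saturation N \<rho> z \<sqsubseteq> y \<longleftrightarrow> z \<sqsubseteq> y"
proof
  have "y \<in> carrier N" using y saturated_closed by blast
  then show "z \<sqsubseteq> y" if "saturation N \<rho> z \<sqsubseteq> y"
    using that z le_trans[OF saturation_upper[OF z]] saturation_closed[OF z] by simp
  show "saturation N \<rho> z \<sqsubseteq> y" if "z \<sqsubseteq> y"
    using that y saturation_least[OF z] unfolding least_def by blast
qed

lemma saturation_id:
  assumes "z \<in> saturated N \<rho>"
  shows "saturation N \<rho> z = z"
proof -
  have "z \<in> carrier N" using assms saturated_closed by blast
  then show ?thesis
    using assms saturation_le_iff[of z z] saturation_upper[of z] saturation_closed[of z]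
    by (simp add: le_antisym)
qed

lemma Q_complete: "complete_lattice Q"
proof -
  have po: "partial_order Q"
    using saturated_closed
    by unfold_locales (auto simp: eq_is_equal intro: le_antisym le_trans)
  show ?thesis
  proof (rule partial_order.complete_latticeI_inf[OF po])
    fix A assume "A \<subseteq> carrier Q"
    then have A: "A \<subseteq> saturated N \<rho>" "A \<subseteq> carrier N"
      using saturated_closed by auto
    have "greatest Q (\<Sqinter>A) (Lower Q A)"
    proof (rule greatest_LowerI)
      fix y assume "y \<in> Lower Q A"
      then have "y \<in> carrier N" "\<forall>x\<in>A. y \<sqsubseteq> x"
        using A saturated_closed by (auto simp: Lower_def)
      then show "y \<sqsubseteq>\<^bsub>Q\<^esub> \<Sqinter>A"
        using A by (simp add: le_inf_iff)
    qed (use A inf_saturated[of A] inf_lower[of A] in simp_all)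
    then show "\<exists>i. greatest Q i (Lower Q A)" ..
  qed
qed

interpretation Q: complete_lattice Q
  by (rule Q_complete)

lemma Q_meet:
  assumes "x \<in> saturated N \<rho>" "y \<in> saturated N \<rho>"
  shows "x \<sqinter>\<^bsub>Q\<^esub> y = x \<sqinter> y"
proof (rule le_antisym)
  have xy: "x \<in> carrier N" "y \<in> carrier N"
    using assms saturated_closed by auto
  have m: "x \<sqinter> y \<in> saturated N \<rho>"
    using inf_saturated[of "{x, y}"] assms unfolding meet_def by simp
  have q: "x \<sqinter>\<^bsub>Q\<^esub> y \<in> saturated N \<rho>"
    using Q.meet_closed[of x y] assms by simp
  show "x \<sqinter>\<^bsub>Q\<^esub> y \<in> carrier N" "x \<sqinter> y \<in> carrier N"
    using q m saturated_closed by auto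
  show "x \<sqinter>\<^bsub>Q\<^esub> y \<sqsubseteq> x \<sqinter> y"
    using Q.meet_left[of x y] Q.meet_right[of x y] xy assms q saturated_closed
    by (intro meet_le) auto
  show "x \<sqinter> y \<sqsubseteq> x \<sqinter>\<^bsub>Q\<^esub> y"
    using Q.meet_le[of "x \<sqinter> y" x y] m assms meet_left[of x y] meet_right[of x y] xy by simp
qed

text \<open>Meets agree with those of \<open>N\<close>, and the implication formed in
  \<open>N\<close> with a saturated conclusion is already saturated, so it serves as implication in
  \<open>Q\<close>.\<close>

lemma Q_frame: "frame Q"
proof (rule Q.frame_if_implication)
  fix x y assume xy: "x \<in> carrier Q" "y \<in> carrier Q"
  then have "x \<in> carrier N" "y \<in> saturated N \<rho>"
    using saturated_closed by auto
  then obtain i where "i \<in> saturated N \<rho>" "\<forall>u\<in>carrier N. x \<sqinter> u \<sqsubseteq> y \<longleftrightarrow> u \<sqsubseteq> i"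
    using ex_saturated_implication[of x y] by blast
  then show "\<exists>i\<in>carrier Q. \<forall>z\<in>carrier Q. x \<sqinter>\<^bsub>Q\<^esub> z \<sqsubseteq>\<^bsub>Q\<^esub> y \<longleftrightarrow> z \<sqsubseteq>\<^bsub>Q\<^esub> i"
    using xy saturated_closed by (intro bexI[of _ i]) (auto simp: Q_meet)
qed

lemma saturation_meet:
  assumes x: "x \<in> carrier N" and y: "y \<in> carrier N"
  shows "saturation N \<rho> (x \<sqinter> y) = saturation N \<rho> x \<sqinter> saturation N \<rho> y"
proof (rule le_antisym)
  let ?s = "saturation N \<rho>" and ?o = "saturation N \<rho> (x \<sqinter> y)"
  have c: "?s x \<in> carrier N" "?s y \<in> carrier N" "?o \<in> carrier N" "x \<sqinter> y \<in> carrier N"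
    using x y by (auto intro: saturation_closed)
  then show "?o \<in> carrier N" "?s x \<sqinter> ?s y \<in> carrier N" by auto
  have o: "?o \<in> saturated N \<rho>"
    using x y by (auto intro: saturation_saturated)
  have "?s x \<sqinter> ?s y \<in> saturated N \<rho>"
    using inf_saturated[of "{?s x, ?s y}"] x y unfolding meet_def
    by (simp add: saturation_saturated)
  then show "?o \<sqsubseteq> ?s x \<sqinter> ?s y"
    using meet_mono[OF x y c(1,2)] x y c by (simp add: saturation_le_iff saturation_upper)
  \<comment> \<open>One factor of a meet may be saturated when the bound is saturated: move
    \<open>v\<close> to the right by implication, use that the implication is saturated, and move
    \<open>v\<close> back. Doing this to each factor in turn gives the nontrivial
    inequality.\<close>
  have step: "v \<sqinter> ?s u \<sqsubseteq> ?o" if v: "v \<in> carrier N" and u: "u \<in> carrier N" and le: "v \<sqinter> u \<sqsubseteq> ?o" for u v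
  proof -
    obtain i where i: "i \<in> saturated N \<rho>" "\<forall>w\<in>carrier N. v \<sqinter> w \<sqsubseteq> ?o \<longleftrightarrow> w \<sqsubseteq> i"
      using ex_saturated_implication[OF v o] by blast
    then show ?thesis
      using u le saturation_le_iff[OF u i(1)] saturation_closed[OF u] by simp
  qed
  have "x \<sqinter> ?s y \<sqsubseteq> ?o"
    using step[OF x y] saturation_upper[OF c(4)] by simp
  then have "?s y \<sqinter> x \<sqsubseteq> ?o"
    using meet_comm[of N x "?s y"] by simp
  then have "?s y \<sqinter> ?s x \<sqsubseteq> ?o"
    using step[OF c(2) x] by simp
  then show "?s x \<sqinter> ?s y \<sqsubseteq> ?o"
    using meet_comm[of N "?s x"] by simp
qed

lemma saturation_frame_hom: "frame_hom N Q (saturation N \<rho>)"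
  unfolding frame_hom_def
proof (intro conjI ballI allI impI)
  show sc: "saturation N \<rho> \<in> carrier N \<rightarrow> carrier Q"
    using saturation_saturated by auto
  show "saturation N \<rho> \<top> = \<top>\<^bsub>Q\<^esub>"
  proof (rule Q.le_antisym)
    have "carrier Q = saturated N \<rho>" by simp
    then have "\<top>\<^bsub>Q\<^esub> \<in> saturated N \<rho>" using Q.top_closed by metis
    then have "\<top>\<^bsub>Q\<^esub> \<in> carrier N" using saturated_closed by blast
    then show "\<top>\<^bsub>Q\<^esub> \<sqsubseteq>\<^bsub>Q\<^esub> saturation N \<rho> \<top>"
      using le_trans[of "\<top>\<^bsub>Q\<^esub>" "\<top>" "saturation N \<rho> \<top>"] saturation_upper[OF top_closed] saturation_closed[OF top_closed]
      by simp
    show "saturation N \<rho> \<top> \<sqsubseteq>\<^bsub>Q\<^esub> \<top>\<^bsub>Q\<^esub>"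
      using Q.top_higher saturation_saturated[OF top_closed] by simp
  qed (use saturation_saturated[OF top_closed] in simp, rule Q.top_closed)
  show "saturation N \<rho> (x \<sqinter> y) = saturation N \<rho> x \<sqinter>\<^bsub>Q\<^esub> saturation N \<rho> y"
    if "x \<in> carrier N" "y \<in> carrier N" for x y
    using that by (simp add: saturation_meet Q_meet saturation_saturated)
  fix A assume A: "A \<subseteq> carrier N"
  have "\<Squnion>\<^bsub>Q\<^esub> (saturation N \<rho> ` A) = saturation N \<rho> (\<Squnion>A)"
  proof (rule Q.sup_eqI)
    show "saturation N \<rho> ` A \<subseteq> carrier Q" "saturation N \<rho> (\<Squnion>A) \<in> carrier Q"
      using A sc by auto
    fix z assume "z \<in> carrier Q"
    then have z: "z \<in> saturated N \<rho>" "z \<in> carrier N" using saturated_closed by auto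
    show "saturation N \<rho> (\<Squnion>A) \<sqsubseteq>\<^bsub>Q\<^esub> z \<longleftrightarrow> (\<forall>a\<in>saturation N \<rho> ` A. a \<sqsubseteq>\<^bsub>Q\<^esub> z)"
      using z A by (simp add: saturation_le_iff sup_le_iff subset_iff)
  qed
  then show "saturation N \<rho> (\<Squnion>A) = \<Squnion>\<^bsub>Q\<^esub> (saturation N \<rho> ` A)" ..
qed

text \<open>Saturated elements are fixed by \<open>saturation\<close>, which gives
  surjectivity.\<close>

lemma quot_subloc_is_sublocale: "is_sublocale N (quot_subloc N \<rho>)"
proof -
  have "saturation N \<rho> ` carrier N = saturated N \<rho>"
  proof
    show "saturated N \<rho> \<subseteq> saturation N \<rho> ` carrier N"
    proof
      fix z assume z: "z \<in> saturated N \<rho>"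
      then have "z = saturation N \<rho> z" "z \<in> carrier N"
        using saturation_id[OF z] saturated_closed by auto
      then show "z \<in> saturation N \<rho> ` carrier N" by (rule image_eqI)
    qed
  qed (auto intro: saturation_saturated)
  then show ?thesis
    using Q_frame saturation_frame_hom frame_axioms
    unfolding is_sublocale_def quot_subloc_def by simp
qed

end


lemma ball_pairs_iff:
  "(\<forall>(x, y)\<in>{(p u, q u) | u. u \<in> K}. P x y) \<longleftrightarrow> (\<forall>u\<in>K. P (p u) (q u))"
  by auto


section \<open>Coproducts of frames\<close>

lemma cp_idealI:
  assumes "U \<subseteq> carrier L \<times> carrier M"
    and "\<And>a b a' b'. \<lbrakk>(a, b) \<in> U; a' \<in> carrier L; b' \<in> carrier M; a' \<sqsubseteq>\<^bsub>L\<^esub> a; b' \<sqsubseteq>\<^bsub>M\<^esub> b\<rbrakk>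
      \<Longrightarrow> (a', b') \<in> U"
    and "\<And>A b. \<lbrakk>A \<subseteq> carrier L; b \<in> carrier M; \<And>a. a \<in> A \<Longrightarrow> (a, b) \<in> U\<rbrakk>
      \<Longrightarrow> (\<Squnion>\<^bsub>L\<^esub> A, b) \<in> U"
    and "\<And>a B. \<lbrakk>a \<in> carrier L; B \<subseteq> carrier M; \<And>b. b \<in> B \<Longrightarrow> (a, b) \<in> U\<rbrakk>
      \<Longrightarrow> (a, \<Squnion>\<^bsub>M\<^esub> B) \<in> U"
  shows "cp_ideal L M U"
  unfolding cp_ideal_def
  by (intro conjI allI impI; (elim conjE)?) (rule assms(1), erule (4) assms(2), simp_all add: assms(3,4))

lemma
  assumes "cp_ideal L M U"
  shows cp_ideal_closed: "U \<subseteq> carrier L \<times> carrier M"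
    and cp_ideal_down: "\<lbrakk>(a, b) \<in> U; a' \<in> carrier L; b' \<in> carrier M; a' \<sqsubseteq>\<^bsub>L\<^esub> a; b' \<sqsubseteq>\<^bsub>M\<^esub> b\<rbrakk>
      \<Longrightarrow> (a', b') \<in> U"
    and cp_ideal_sup1: "\<lbrakk>A \<subseteq> carrier L; b \<in> carrier M; \<And>a. a \<in> A \<Longrightarrow> (a, b) \<in> U\<rbrakk>
      \<Longrightarrow> (\<Squnion>\<^bsub>L\<^esub> A, b) \<in> U"
    and cp_ideal_sup2: "\<lbrakk>a \<in> carrier L; B \<subseteq> carrier M; \<And>b. b \<in> B \<Longrightarrow> (a, b) \<in> U\<rbrakk>
      \<Longrightarrow> (a, \<Squnion>\<^bsub>M\<^esub> B) \<in> U"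
proof -
  note U = assms[unfolded cp_ideal_def]
  show "U \<subseteq> carrier L \<times> carrier M"
    by (rule conjunct1[OF U])
  show "(a', b') \<in> U"
    if "(a, b) \<in> U" "a' \<in> carrier L" "b' \<in> carrier M" "a' \<sqsubseteq>\<^bsub>L\<^esub> a" "b' \<sqsubseteq>\<^bsub>M\<^esub> b"
    using conjunct1[OF conjunct2[OF U], rule_format, of a b a' b'] that by simp
  show "(\<Squnion>\<^bsub>L\<^esub> A, b) \<in> U"
    if "A \<subseteq> carrier L" "b \<in> carrier M" "\<And>a. a \<in> A \<Longrightarrow> (a, b) \<in> U"
    using conjunct1[OF conjunct2[OF conjunct2[OF U]], rule_format, of A b] that by simp
  show "(a, \<Squnion>\<^bsub>M\<^esub> B) \<in> U"
    if "a \<in> carrier L" "B \<subseteq> carrier M" "\<And>b. b \<in> B \<Longrightarrow> (a, b) \<in> U"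
    using conjunct2[OF conjunct2[OF conjunct2[OF U]], rule_format, of a B] that by simp
qed

lemma tensor_simps [simp]:
  "carrier (tensor L M) = {U. cp_ideal L M U}"
  "U \<sqsubseteq>\<^bsub>tensor L M\<^esub> V \<longleftrightarrow> U \<subseteq> V"
  "(.=\<^bsub>tensor L M\<^esub>) = (=)"
  unfolding tensor_def by simp_all

locale two_frames = L: frame L + M: frame M for L :: "'a gorder" and M :: "'b gorder"
begin

abbreviation T :: "('a \<times> 'b) set gorder" where
  "T \<equiv> tensor L M"

text \<open>The intersection with the full carrier makes the empty family yield the top element
  instead of the universal set.\<close>

lemma cp_ideal_Inter:
  assumes "\<And>U. U \<in> \<A> \<Longrightarrow> cp_ideal L M U"
  shows "cp_ideal L M (carrier L \<times> carrier M \<inter> \<Inter>\<A>)"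
proof (rule cp_idealI)
  fix a b a' b'
  assume "(a, b) \<in> carrier L \<times> carrier M \<inter> \<Inter>\<A>" "a' \<in> carrier L" "b' \<in> carrier M"
    "a' \<sqsubseteq>\<^bsub>L\<^esub> a" "b' \<sqsubseteq>\<^bsub>M\<^esub> b"
  then show "(a', b') \<in> carrier L \<times> carrier M \<inter> \<Inter>\<A>"
    using cp_ideal_down[OF assms] by blast
next
  fix A b
  assume "A \<subseteq> carrier L" "b \<in> carrier M"
    "\<And>a. a \<in> A \<Longrightarrow> (a, b) \<in> carrier L \<times> carrier M \<inter> \<Inter>\<A>"
  then show "(\<Squnion>\<^bsub>L\<^esub> A, b) \<in> carrier L \<times> carrier M \<inter> \<Inter>\<A>"
    using cp_ideal_sup1[OF assms, of _ A b] by auto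
next
  fix a B
  assume "a \<in> carrier L" "B \<subseteq> carrier M"
    "\<And>b. b \<in> B \<Longrightarrow> (a, b) \<in> carrier L \<times> carrier M \<inter> \<Inter>\<A>"
  then show "(a, \<Squnion>\<^bsub>M\<^esub> B) \<in> carrier L \<times> carrier M \<inter> \<Inter>\<A>"
    using cp_ideal_sup2[OF assms, of _ a B] by auto
qed blast

lemma cp_ideal_carrier: "cp_ideal L M (carrier L \<times> carrier M)"
  using cp_ideal_Inter[of "{}"] by simp

lemma cp_ideal_Int:
  assumes "cp_ideal L M U" "cp_ideal L M V"
  shows "cp_ideal L M (U \<inter> V)"
proof -
  have "carrier L \<times> carrier M \<inter> \<Inter>{U, V} = U \<inter> V"
    using cp_ideal_closed[OF assms(1)] by auto
  then show ?thesis
    using cp_ideal_Inter[of "{U, V}"] assms by auto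
qed

lemma tensor_complete: "complete_lattice T"
proof (rule partial_order.complete_latticeI_inf)
  show "partial_order T"
    by unfold_locales auto
  fix \<A> assume A: "\<A> \<subseteq> carrier T"
  then have "cp_ideal L M (carrier L \<times> carrier M \<inter> \<Inter>\<A>)"
    by (intro cp_ideal_Inter) auto
  then have "greatest T (carrier L \<times> carrier M \<inter> \<Inter>\<A>) (Lower T \<A>)"
    using A by (intro greatest_LowerI) (auto simp: Lower_def dest: cp_ideal_closed)
  then show "\<exists>i. greatest T i (Lower T \<A>)" ..
qed

interpretation T: complete_lattice T
  by (rule tensor_complete)

lemma tensor_meet:
  assumes U: "cp_ideal L M U" and V: "cp_ideal L M V"
  shows "U \<sqinter>\<^bsub>T\<^esub> V = U \<inter> V"
proof
  show "U \<sqinter>\<^bsub>T\<^esub> V \<subseteq> U \<inter> V"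
    using T.meet_left[of U V] T.meet_right[of U V] assms by simp
  show "U \<inter> V \<subseteq> U \<sqinter>\<^bsub>T\<^esub> V"
    using T.meet_le[of "U \<inter> V" U V] assms cp_ideal_Int by simp
qed

text \<open>Meeting with \<open>a\<close> and with \<open>b\<close> distributes over joins in each
  variable, so pulling an ideal back along these meets gives an ideal. This set is the implication
  from the rectangle on \<open>(a, b)\<close> to \<open>W\<close>.\<close>

lemma cp_ideal_shift:
  assumes W: "cp_ideal L M W" and a: "a \<in> carrier L" and b: "b \<in> carrier M"
  shows "cp_ideal L M {(c, d) \<in> carrier L \<times> carrier M. (a \<sqinter>\<^bsub>L\<^esub> c, b \<sqinter>\<^bsub>M\<^esub> d) \<in> W}"
    (is "cp_ideal L M ?S")
proof (rule cp_idealI)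
  fix c d c' d'
  assume cd: "(c, d) \<in> ?S" and c': "c' \<in> carrier L" "c' \<sqsubseteq>\<^bsub>L\<^esub> c" and d': "d' \<in> carrier M" "d' \<sqsubseteq>\<^bsub>M\<^esub> d"
  have "(a \<sqinter>\<^bsub>L\<^esub> c', b \<sqinter>\<^bsub>M\<^esub> d') \<in> W"
  proof (rule cp_ideal_down[OF W])
    show "(a \<sqinter>\<^bsub>L\<^esub> c, b \<sqinter>\<^bsub>M\<^esub> d) \<in> W" using cd by simp
    show "a \<sqinter>\<^bsub>L\<^esub> c' \<sqsubseteq>\<^bsub>L\<^esub> a \<sqinter>\<^bsub>L\<^esub> c" using cd c' a by (intro L.meet_mono) auto
    show "b \<sqinter>\<^bsub>M\<^esub> d' \<sqsubseteq>\<^bsub>M\<^esub> b \<sqinter>\<^bsub>M\<^esub> d" using cd d' b by (intro M.meet_mono) auto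
  qed (use a b c' d' in simp_all)
  then show "(c', d') \<in> ?S" using c' d' by simp
next
  fix A d
  assume A: "A \<subseteq> carrier L" "d \<in> carrier M" "\<And>c. c \<in> A \<Longrightarrow> (c, d) \<in> ?S"
  have "(\<Squnion>\<^bsub>L\<^esub> ((\<lambda>c. a \<sqinter>\<^bsub>L\<^esub> c) ` A), b \<sqinter>\<^bsub>M\<^esub> d) \<in> W"
    using A a b by (intro cp_ideal_sup1[OF W]) auto
  then show "(\<Squnion>\<^bsub>L\<^esub> A, d) \<in> ?S"
    using A a L.inf_Sup_distrib[OF a A(1)] by simp
next
  fix c B
  assume B: "c \<in> carrier L" "B \<subseteq> carrier M" "\<And>d. d \<in> B \<Longrightarrow> (c, d) \<in> ?S"
  have "(a \<sqinter>\<^bsub>L\<^esub> c, \<Squnion>\<^bsub>M\<^esub> ((\<lambda>d. b \<sqinter>\<^bsub>M\<^esub> d) ` B)) \<in> W"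
    using B a b by (intro cp_ideal_sup2[OF W]) auto
  then show "(c, \<Squnion>\<^bsub>M\<^esub> B) \<in> ?S"
    using B b M.inf_Sup_distrib[OF b B(2)] by simp
qed blast

lemma tensor_frame: "frame T"
proof (rule T.frame_if_implication)
  fix V W assume "V \<in> carrier T" "W \<in> carrier T"
  then have V: "cp_ideal L M V" and W: "cp_ideal L M W" by simp_all
  let ?S = "\<lambda>(a, b). {(c, d) \<in> carrier L \<times> carrier M. (a \<sqinter>\<^bsub>L\<^esub> c, b \<sqinter>\<^bsub>M\<^esub> d) \<in> W}"
  \<comment> \<open>Since \<open>V\<close> is the join of the rectangles on its pairs, the
    implication from \<open>V\<close> to \<open>W\<close> is the intersection of the implications
    from those rectangles.\<close>
  let ?I = "carrier L \<times> carrier M \<inter> \<Inter>(?S ` V)"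
  have I: "cp_ideal L M ?I"
    using cp_ideal_shift[OF W] cp_ideal_closed[OF V] by (intro cp_ideal_Inter) auto
  have "V \<inter> U \<subseteq> W \<longleftrightarrow> U \<subseteq> ?I" if U: "cp_ideal L M U" for U
  proof
    assume le: "V \<inter> U \<subseteq> W"
    have "(a \<sqinter>\<^bsub>L\<^esub> c, b \<sqinter>\<^bsub>M\<^esub> d) \<in> W" if ab: "(a, b) \<in> V" and cd: "(c, d) \<in> U" for a b c d
    proof -
      have c: "a \<in> carrier L" "b \<in> carrier M" "c \<in> carrier L" "d \<in> carrier M"
        using ab cd cp_ideal_closed[OF U] cp_ideal_closed[OF V] by auto
      then have "(a \<sqinter>\<^bsub>L\<^esub> c, b \<sqinter>\<^bsub>M\<^esub> d) \<in> V" "(a \<sqinter>\<^bsub>L\<^esub> c, b \<sqinter>\<^bsub>M\<^esub> d) \<in> U"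
        using L.meet_left[of a c] L.meet_right[of a c] M.meet_left[of b d] M.meet_right[of b d]
        by (auto intro: cp_ideal_down[OF V ab] cp_ideal_down[OF U cd])
      then show ?thesis using le by blast
    qed
    then show "U \<subseteq> ?I"
      using cp_ideal_closed[OF U] by auto
  next
    assume le: "U \<subseteq> ?I"
    show "V \<inter> U \<subseteq> W"
    proof clarify
      fix a b assume ab: "(a, b) \<in> V" "(a, b) \<in> U"
      then have "a \<in> carrier L" "b \<in> carrier M" "(a \<sqinter>\<^bsub>L\<^esub> a, b \<sqinter>\<^bsub>M\<^esub> b) \<in> W"
        using le cp_ideal_closed[OF U] by auto
      then show "(a, b) \<in> W"
        using L.meet_eq_left[of a a] M.meet_eq_left[of b b] by simp
    qed
  qed
  then show "\<exists>I\<in>carrier T. \<forall>U\<in>carrier T. V \<sqinter>\<^bsub>T\<^esub> U \<sqsubseteq>\<^bsub>T\<^esub> W \<longleftrightarrow> U \<sqsubseteq>\<^bsub>T\<^esub> I"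
    using I V by (intro bexI[of _ ?I]) (simp_all add: tensor_meet)
qed

section \<open>Rectangles and tests for saturation\<close>

lemma cp_ideal_cp_gen:
  assumes "a \<in> carrier L" "b \<in> carrier M"
  shows "cp_ideal L M (cp_gen L M a b)"
proof -
  have "cp_gen L M a b = carrier L \<times> carrier M \<inter> \<Inter>{U. cp_ideal L M U \<and> (a, b) \<in> U}"
    using assms cp_ideal_carrier unfolding cp_gen_def by blast
  then show ?thesis
    using cp_ideal_Inter[of "{U. cp_ideal L M U \<and> (a, b) \<in> U}"] by simp
qed

lemma cp_gen_subset_iff: "cp_ideal L M U \<Longrightarrow> cp_gen L M a b \<subseteq> U \<longleftrightarrow> (a, b) \<in> U"
  unfolding cp_gen_def by blast

lemma mem_cp_gen: "(a, b) \<in> cp_gen L M a b"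
  unfolding cp_gen_def by blast

text \<open>This replaces an inclusion between ideals by membership of individual pairs, although no
  explicit description of the elements of \<open>cp_gen L M a b\<close> is available.\<close>

lemma cp_gen_meet_subset_iff:
  assumes a: "a \<in> carrier L" and b: "b \<in> carrier M" and W: "cp_ideal L M W" and U: "cp_ideal L M U"
  shows "cp_gen L M a b \<sqinter>\<^bsub>T\<^esub> W \<subseteq> U \<longleftrightarrow> (\<forall>(x, y)\<in>W. (a \<sqinter>\<^bsub>L\<^esub> x, b \<sqinter>\<^bsub>M\<^esub> y) \<in> U)"
proof -
  note G = cp_ideal_cp_gen[OF a b]
  have "cp_gen L M a b \<inter> W \<subseteq> U \<longleftrightarrow> (\<forall>(x, y)\<in>W. (a \<sqinter>\<^bsub>L\<^esub> x, b \<sqinter>\<^bsub>M\<^esub> y) \<in> U)"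
  proof
    assume le: "cp_gen L M a b \<inter> W \<subseteq> U"
    have "(a \<sqinter>\<^bsub>L\<^esub> x, b \<sqinter>\<^bsub>M\<^esub> y) \<in> U" if xy: "(x, y) \<in> W" for x y
    proof -
      have c: "x \<in> carrier L" "y \<in> carrier M"
        using xy cp_ideal_closed[OF W] by auto
      have "(a \<sqinter>\<^bsub>L\<^esub> x, b \<sqinter>\<^bsub>M\<^esub> y) \<in> cp_gen L M a b"
        using a b c L.meet_left[of a x] M.meet_left[of b y]
        by (intro cp_ideal_down[OF G mem_cp_gen]) simp_all
      moreover have "(a \<sqinter>\<^bsub>L\<^esub> x, b \<sqinter>\<^bsub>M\<^esub> y) \<in> W"
        using a b c L.meet_right[of a x] M.meet_right[of b y]
        by (intro cp_ideal_down[OF W xy]) simp_all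
      ultimately show ?thesis using le by blast
    qed
    then show "\<forall>(x, y)\<in>W. (a \<sqinter>\<^bsub>L\<^esub> x, b \<sqinter>\<^bsub>M\<^esub> y) \<in> U" by blast
  next
    assume *: "\<forall>(x, y)\<in>W. (a \<sqinter>\<^bsub>L\<^esub> x, b \<sqinter>\<^bsub>M\<^esub> y) \<in> U"
    show "cp_gen L M a b \<inter> W \<subseteq> U"
    proof clarify
      fix x y assume xy: "(x, y) \<in> cp_gen L M a b" "(x, y) \<in> W"
      have c: "x \<in> carrier L" "y \<in> carrier M"
        using xy(2) cp_ideal_closed[OF W] by auto
      have "(a \<sqinter>\<^bsub>L\<^esub> x, b \<sqinter>\<^bsub>M\<^esub> y) \<in> U"
        using * xy(2) by auto
      then have "(x \<sqinter>\<^bsub>L\<^esub> a, y \<sqinter>\<^bsub>M\<^esub> b) \<in> U"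
        using meet_comm[of L x a] meet_comm[of M y b] by simp
      \<comment> \<open>Read with the roles exchanged, the membership says that
        \<open>(a, b)\<close> lies in the shift of \<open>U\<close> by \<open>(x, y)\<close>. Hence
        so does the whole ideal generated by \<open>(a, b)\<close>, in particular
        \<open>(x, y)\<close> itself; idempotence of meets finishes.\<close>
      then have "cp_gen L M a b \<subseteq> {(c, d) \<in> carrier L \<times> carrier M. (x \<sqinter>\<^bsub>L\<^esub> c, y \<sqinter>\<^bsub>M\<^esub> d) \<in> U}"
        using cp_gen_subset_iff[OF cp_ideal_shift[OF U c]] a b by simp
      then have "(x \<sqinter>\<^bsub>L\<^esub> x, y \<sqinter>\<^bsub>M\<^esub> y) \<in> U"
        using xy(1) by auto
      then show "(x, y) \<in> U"
        using c L.meet_eq_left[of x x] M.meet_eq_left[of y y] by simp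
    qed
  qed
  then show ?thesis
    by (simp add: tensor_meet[OF G W])
qed

lemma cp_gen_meet:
  assumes a: "a \<in> carrier L" and b: "b \<in> carrier M" and c: "c \<in> carrier L" and d: "d \<in> carrier M"
  shows "cp_gen L M a b \<sqinter>\<^bsub>T\<^esub> cp_gen L M c d = cp_gen L M (a \<sqinter>\<^bsub>L\<^esub> c) (b \<sqinter>\<^bsub>M\<^esub> d)"
proof (rule T.eq_if_same_upper_bounds)
  note G = cp_ideal_cp_gen[OF c d]
  fix U assume "U \<in> carrier T"
  then have U: "cp_ideal L M U" by simp
  have "cp_gen L M a b \<sqinter>\<^bsub>T\<^esub> cp_gen L M c d \<subseteq> U \<longleftrightarrow>
      cp_gen L M c d \<subseteq> {(x, y) \<in> carrier L \<times> carrier M. (a \<sqinter>\<^bsub>L\<^esub> x, b \<sqinter>\<^bsub>M\<^esub> y) \<in> U}"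
    using cp_gen_meet_subset_iff[OF a b G U] cp_ideal_closed[OF G] by auto
  also have "\<dots> \<longleftrightarrow> cp_gen L M (a \<sqinter>\<^bsub>L\<^esub> c) (b \<sqinter>\<^bsub>M\<^esub> d) \<subseteq> U"
    using cp_gen_subset_iff[OF cp_ideal_shift[OF U a b]] cp_gen_subset_iff[OF U] c d by simp
  finally show "cp_gen L M a b \<sqinter>\<^bsub>T\<^esub> cp_gen L M c d \<sqsubseteq>\<^bsub>T\<^esub> U \<longleftrightarrow>
      cp_gen L M (a \<sqinter>\<^bsub>L\<^esub> c) (b \<sqinter>\<^bsub>M\<^esub> d) \<sqsubseteq>\<^bsub>T\<^esub> U"
    by simp
qed (use assms cp_ideal_cp_gen T.meet_closed in simp_all)

text \<open>Rectangles generate the coproduct under joins, so it suffices to test saturation against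
  rectangles, where meets are computed componentwise.\<close>

lemma cp_gen_pair_saturated_iff:
  assumes a: "a \<in> carrier L" and b: "b \<in> carrier M" and c: "c \<in> carrier L" and d: "d \<in> carrier M"
    and U: "cp_ideal L M U"
  shows "(\<forall>W\<in>carrier T. cp_gen L M a b \<sqinter>\<^bsub>T\<^esub> W \<sqsubseteq>\<^bsub>T\<^esub> U \<longleftrightarrow> cp_gen L M c d \<sqinter>\<^bsub>T\<^esub> W \<sqsubseteq>\<^bsub>T\<^esub> U) \<longleftrightarrow>
    (\<forall>x\<in>carrier L. \<forall>y\<in>carrier M.
      (a \<sqinter>\<^bsub>L\<^esub> x, b \<sqinter>\<^bsub>M\<^esub> y) \<in> U \<longleftrightarrow> (c \<sqinter>\<^bsub>L\<^esub> x, d \<sqinter>\<^bsub>M\<^esub> y) \<in> U)" (is "?l \<longleftrightarrow> ?r")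
proof
  assume l: ?l
  show ?r
  proof (intro ballI)
    fix x y assume xy: "x \<in> carrier L" "y \<in> carrier M"
    show "(a \<sqinter>\<^bsub>L\<^esub> x, b \<sqinter>\<^bsub>M\<^esub> y) \<in> U \<longleftrightarrow> (c \<sqinter>\<^bsub>L\<^esub> x, d \<sqinter>\<^bsub>M\<^esub> y) \<in> U"
      using bspec[OF l, of "cp_gen L M x y"] cp_ideal_cp_gen[OF xy]
      by (simp add: cp_gen_meet a b c d xy cp_gen_subset_iff[OF U])
  qed
next
  assume r: ?r
  show ?l
  proof
    fix W assume "W \<in> carrier T"
    then have W: "cp_ideal L M W" by simp
    show "cp_gen L M a b \<sqinter>\<^bsub>T\<^esub> W \<sqsubseteq>\<^bsub>T\<^esub> U \<longleftrightarrow> cp_gen L M c d \<sqinter>\<^bsub>T\<^esub> W \<sqsubseteq>\<^bsub>T\<^esub> U"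
      unfolding tensor_simps cp_gen_meet_subset_iff[OF a b W U] cp_gen_meet_subset_iff[OF c d W U]
      using r cp_ideal_closed[OF W] by (intro ball_cong) auto
  qed
qed

text \<open>The generators are the rectangles on \<open>(f u, \<top>)\<close> and
  \<open>(\<top>, g u)\<close>. Saturation therefore means that \<open>f u\<close> in the first
  component may be traded for \<open>g u\<close> in the second.\<close>

lemma pushout_saturated_iff:
  assumes f: "\<And>u. u \<in> K \<Longrightarrow> f u \<in> carrier L" and g: "\<And>u. u \<in> K \<Longrightarrow> g u \<in> carrier M"
  shows "U \<in> saturated T {(inj1 L M (f u), inj2 L M (g u)) | u. u \<in> K} \<longleftrightarrow>
    cp_ideal L M U \<and> (\<forall>u\<in>K. \<forall>x\<in>carrier L. \<forall>y\<in>carrier M.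
      (f u \<sqinter>\<^bsub>L\<^esub> x, y) \<in> U \<longleftrightarrow> (x, g u \<sqinter>\<^bsub>M\<^esub> y) \<in> U)"
proof (cases "cp_ideal L M U")
  case True
  have "U \<in> saturated T {(inj1 L M (f u), inj2 L M (g u)) | u. u \<in> K} \<longleftrightarrow>
      (\<forall>u\<in>K. \<forall>W\<in>carrier T. inj1 L M (f u) \<sqinter>\<^bsub>T\<^esub> W \<sqsubseteq>\<^bsub>T\<^esub> U \<longleftrightarrow> inj2 L M (g u) \<sqinter>\<^bsub>T\<^esub> W \<sqsubseteq>\<^bsub>T\<^esub> U)"
    using True unfolding saturated_def ball_pairs_iff by simp
  also have "\<dots> \<longleftrightarrow> (\<forall>u\<in>K. \<forall>x\<in>carrier L. \<forall>y\<in>carrier M.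
      (f u \<sqinter>\<^bsub>L\<^esub> x, y) \<in> U \<longleftrightarrow> (x, g u \<sqinter>\<^bsub>M\<^esub> y) \<in> U)"
    unfolding inj1_def inj2_def
    using f g True by (intro ball_cong refl) (simp only: cp_gen_pair_saturated_iff L.meet_top M.meet_top
        L.top_closed M.top_closed cong: ball_cong)
  finally show ?thesis using True by simp
qed (simp add: saturated_def)

lemma rect_eq_cp_gen:
  assumes "a \<in> carrier L" "b \<in> carrier M"
  shows "rect L M a b = cp_gen L M a b"
  unfolding rect_def inj1_def inj2_def
  using assms by (simp add: cp_gen_meet L.meet_top M.meet_top)

section \<open>The coproduct injections\<close>

lemma inj1_closed: "a \<in> carrier L \<Longrightarrow> cp_ideal L M (inj1 L M a)"
  unfolding inj1_def by (simp add: cp_ideal_cp_gen)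

lemma inj2_closed: "b \<in> carrier M \<Longrightarrow> cp_ideal L M (inj2 L M b)"
  unfolding inj2_def by (simp add: cp_ideal_cp_gen)

lemma tensor_top: "\<top>\<^bsub>T\<^esub> = carrier L \<times> carrier M"
proof
  show "\<top>\<^bsub>T\<^esub> \<subseteq> carrier L \<times> carrier M"
    using T.top_closed unfolding tensor_simps mem_Collect_eq by (rule cp_ideal_closed)
  show "carrier L \<times> carrier M \<subseteq> \<top>\<^bsub>T\<^esub>"
    using T.top_higher[of "carrier L \<times> carrier M"] cp_ideal_carrier by simp
qed

lemma cp_gen_top: "cp_gen L M \<top>\<^bsub>L\<^esub> \<top>\<^bsub>M\<^esub> = \<top>\<^bsub>T\<^esub>"
proof -
  have *: "cp_ideal L M (cp_gen L M \<top>\<^bsub>L\<^esub> \<top>\<^bsub>M\<^esub>)"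
    by (simp add: cp_ideal_cp_gen)
  then have "carrier L \<times> carrier M \<subseteq> cp_gen L M \<top>\<^bsub>L\<^esub> \<top>\<^bsub>M\<^esub>"
    using cp_ideal_down[OF * mem_cp_gen] by auto
  then show ?thesis
    using cp_ideal_closed[OF *] tensor_top by auto
qed

lemma sup_hom_inj1: "sup_hom L T (inj1 L M)"
  unfolding sup_hom_def
proof (intro conjI allI impI)
  show "inj1 L M \<in> carrier L \<rightarrow> carrier T"
    by (simp add: inj1_closed)
  fix A assume A: "A \<subseteq> carrier L"
  have "\<Squnion>\<^bsub>T\<^esub> (inj1 L M ` A) = inj1 L M (\<Squnion>\<^bsub>L\<^esub> A)"
  proof (rule T.sup_eqI)
    fix U assume "U \<in> carrier T"
    then have U: "cp_ideal L M U" by simp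
    have "(\<Squnion>\<^bsub>L\<^esub> A, \<top>\<^bsub>M\<^esub>) \<in> U \<longleftrightarrow> (\<forall>a\<in>A. (a, \<top>\<^bsub>M\<^esub>) \<in> U)"
    proof
      assume "(\<Squnion>\<^bsub>L\<^esub> A, \<top>\<^bsub>M\<^esub>) \<in> U"
      then show "\<forall>a\<in>A. (a, \<top>\<^bsub>M\<^esub>) \<in> U"
        using A L.sup_upper[OF A] by (intro ballI) (erule cp_ideal_down[OF U], auto)
    qed (use A in \<open>simp add: cp_ideal_sup1[OF U]\<close>)
    then show "inj1 L M (\<Squnion>\<^bsub>L\<^esub> A) \<sqsubseteq>\<^bsub>T\<^esub> U \<longleftrightarrow> (\<forall>a\<in>inj1 L M ` A. a \<sqsubseteq>\<^bsub>T\<^esub> U)"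
      using U by (simp add: inj1_def cp_gen_subset_iff)
  qed (use A inj1_closed in auto)
  then show "inj1 L M (\<Squnion>\<^bsub>L\<^esub> A) = \<Squnion>\<^bsub>T\<^esub> (inj1 L M ` A)" ..
qed

lemma sup_hom_inj2: "sup_hom M T (inj2 L M)"
  unfolding sup_hom_def
proof (intro conjI allI impI)
  show "inj2 L M \<in> carrier M \<rightarrow> carrier T"
    by (simp add: inj2_closed)
  fix B assume B: "B \<subseteq> carrier M"
  have "\<Squnion>\<^bsub>T\<^esub> (inj2 L M ` B) = inj2 L M (\<Squnion>\<^bsub>M\<^esub> B)"
  proof (rule T.sup_eqI)
    fix U assume "U \<in> carrier T"
    then have U: "cp_ideal L M U" by simp
    have "(\<top>\<^bsub>L\<^esub>, \<Squnion>\<^bsub>M\<^esub> B) \<in> U \<longleftrightarrow> (\<forall>b\<in>B. (\<top>\<^bsub>L\<^esub>, b) \<in> U)"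
    proof
      assume "(\<top>\<^bsub>L\<^esub>, \<Squnion>\<^bsub>M\<^esub> B) \<in> U"
      then show "\<forall>b\<in>B. (\<top>\<^bsub>L\<^esub>, b) \<in> U"
        using B M.sup_upper[OF B] by (intro ballI) (erule cp_ideal_down[OF U], auto)
    qed (use B in \<open>simp add: cp_ideal_sup2[OF U]\<close>)
    then show "inj2 L M (\<Squnion>\<^bsub>M\<^esub> B) \<sqsubseteq>\<^bsub>T\<^esub> U \<longleftrightarrow> (\<forall>b\<in>inj2 L M ` B. b \<sqsubseteq>\<^bsub>T\<^esub> U)"
      using U by (simp add: inj2_def cp_gen_subset_iff)
  qed (use B inj2_closed in auto)
  then show "inj2 L M (\<Squnion>\<^bsub>M\<^esub> B) = \<Squnion>\<^bsub>T\<^esub> (inj2 L M ` B)" ..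
qed

end

text \<open>Only preservation of joins is required of \<open>f\<close> and \<open>g\<close>, so that
  the pair consisting of \<open>s\<close> after \<open>t_!\<close> and the identity is covered
  besides pairs of frame maps.\<close>

locale sup_hom_pair = two_frames L M + Z: frame Z
  for L :: "'a gorder" and M :: "'b gorder" and Z :: "'z gorder" +
  fixes f g
  assumes f: "sup_hom L Z f" and g: "sup_hom M Z g"
begin

text \<open>The map sending \<open>(a, b)\<close> to \<open>f a \<sqinter> g b\<close> preserves
  joins in each variable, because \<open>f\<close> and \<open>g\<close> do and meets in
  \<open>Z\<close> distribute over joins. Implication in \<open>Z\<close> carries out the
  distribution.\<close>

lemma cp_ideal_le:
  assumes z: "z \<in> carrier Z"
  shows "cp_ideal L M {(a, b) \<in> carrier L \<times> carrier M. f a \<sqinter>\<^bsub>Z\<^esub> g b \<sqsubseteq>\<^bsub>Z\<^esub> z}" (is "cp_ideal L M ?S")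
proof (rule cp_idealI)
  fix a b a' b'
  assume ab: "(a, b) \<in> ?S" and a': "a' \<in> carrier L" "a' \<sqsubseteq>\<^bsub>L\<^esub> a" and b': "b' \<in> carrier M" "b' \<sqsubseteq>\<^bsub>M\<^esub> b"
  have abc: "a \<in> carrier L" "b \<in> carrier M" using ab by auto
  note c = sup_hom_closed[OF f] sup_hom_closed[OF g]
  have "f a' \<sqsubseteq>\<^bsub>Z\<^esub> f a" "g b' \<sqsubseteq>\<^bsub>Z\<^esub> g b"
    using sup_hom_mono[OF _ _ f a'(1) abc(1) a'(2)] sup_hom_mono[OF _ _ g b'(1) abc(2) b'(2)]
      L.complete_lattice_axioms M.complete_lattice_axioms Z.complete_lattice_axioms by auto
  then have "f a' \<sqinter>\<^bsub>Z\<^esub> g b' \<sqsubseteq>\<^bsub>Z\<^esub> f a \<sqinter>\<^bsub>Z\<^esub> g b"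
    using abc a' b' c by (intro Z.meet_mono) auto
  then have "f a' \<sqinter>\<^bsub>Z\<^esub> g b' \<sqsubseteq>\<^bsub>Z\<^esub> z"
    using ab abc a' b' c z by (intro Z.le_trans[of "f a' \<sqinter>\<^bsub>Z\<^esub> g b'" "f a \<sqinter>\<^bsub>Z\<^esub> g b" z]) auto
  then show "(a', b') \<in> ?S" using a' b' by simp
next
  fix A b
  assume A: "A \<subseteq> carrier L" "b \<in> carrier M" "\<And>a. a \<in> A \<Longrightarrow> (a, b) \<in> ?S"
  have fA: "f ` A \<subseteq> carrier Z" and gb: "g b \<in> carrier Z"
    using A sup_hom_closed[OF f] sup_hom_closed[OF g] by auto
  obtain i where i: "i \<in> carrier Z" "\<forall>u\<in>carrier Z. g b \<sqinter>\<^bsub>Z\<^esub> u \<sqsubseteq>\<^bsub>Z\<^esub> z \<longleftrightarrow> u \<sqsubseteq>\<^bsub>Z\<^esub> i"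
    using Z.ex_implication[OF gb z] by blast
  have "f a \<sqsubseteq>\<^bsub>Z\<^esub> i" if "a \<in> A" for a
    using A(3)[OF that] fA that i meet_comm[of Z "g b" "f a"] by (auto simp: image_subset_iff)
  then have "\<Squnion>\<^bsub>Z\<^esub> (f ` A) \<sqsubseteq>\<^bsub>Z\<^esub> i"
    using fA i by (simp add: Z.sup_le_iff)
  then have "f (\<Squnion>\<^bsub>L\<^esub> A) \<sqinter>\<^bsub>Z\<^esub> g b \<sqsubseteq>\<^bsub>Z\<^esub> z"
    using sup_hom_sup[OF f A(1)] fA i meet_comm[of Z "\<Squnion>\<^bsub>Z\<^esub> (f ` A)" "g b"] by simp
  then show "(\<Squnion>\<^bsub>L\<^esub> A, b) \<in> ?S" using A by simp
next
  fix a B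
  assume B: "a \<in> carrier L" "B \<subseteq> carrier M" "\<And>b. b \<in> B \<Longrightarrow> (a, b) \<in> ?S"
  have gB: "g ` B \<subseteq> carrier Z" and fa: "f a \<in> carrier Z"
    using B sup_hom_closed[OF f] sup_hom_closed[OF g] by auto
  obtain i where i: "i \<in> carrier Z" "\<forall>u\<in>carrier Z. f a \<sqinter>\<^bsub>Z\<^esub> u \<sqsubseteq>\<^bsub>Z\<^esub> z \<longleftrightarrow> u \<sqsubseteq>\<^bsub>Z\<^esub> i"
    using Z.ex_implication[OF fa z] by blast
  have "g b \<sqsubseteq>\<^bsub>Z\<^esub> i" if "b \<in> B" for b
    using B(3)[OF that] gB that i by (auto simp: image_subset_iff)
  then have "\<Squnion>\<^bsub>Z\<^esub> (g ` B) \<sqsubseteq>\<^bsub>Z\<^esub> i"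
    using gB i by (simp add: Z.sup_le_iff)
  then have "f a \<sqinter>\<^bsub>Z\<^esub> g (\<Squnion>\<^bsub>M\<^esub> B) \<sqsubseteq>\<^bsub>Z\<^esub> z"
    using sup_hom_sup[OF g B(2)] gB i by simp
  then show "(a, \<Squnion>\<^bsub>M\<^esub> B) \<in> ?S" using B by simp
qed blast

lemma copair_image_closed:
  assumes "cp_ideal L M U"
  shows "(\<lambda>(a, b). f a \<sqinter>\<^bsub>Z\<^esub> g b) ` U \<subseteq> carrier Z"
  using cp_ideal_closed[OF assms] sup_hom_closed[OF f] sup_hom_closed[OF g] by auto

lemma copair_closed: "cp_ideal L M U \<Longrightarrow> copair Z f g U \<in> carrier Z"
  unfolding copair_def by (simp add: copair_image_closed)

lemma copair_le_iff:
  assumes "cp_ideal L M U" "z \<in> carrier Z"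
  shows "copair Z f g U \<sqsubseteq>\<^bsub>Z\<^esub> z \<longleftrightarrow> (\<forall>(a, b)\<in>U. f a \<sqinter>\<^bsub>Z\<^esub> g b \<sqsubseteq>\<^bsub>Z\<^esub> z)"
  unfolding copair_def using Z.sup_le_iff[OF copair_image_closed] assms by auto

lemma copair_mono:
  assumes "cp_ideal L M U" "cp_ideal L M V" "U \<subseteq> V"
  shows "copair Z f g U \<sqsubseteq>\<^bsub>Z\<^esub> copair Z f g V"
  using assms copair_le_iff[of V "copair Z f g V"] copair_le_iff[of U "copair Z f g V"]
    copair_closed[of V] by auto

text \<open>A bound \<open>z\<close> for the value at \<open>(a, b)\<close> puts
  \<open>(a, b)\<close> into the ideal of \<open>cp_ideal_le\<close>, which then contains everything
  generated by \<open>(a, b)\<close>.\<close>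

lemma copair_cp_gen:
  assumes a: "a \<in> carrier L" and b: "b \<in> carrier M"
  shows "copair Z f g (cp_gen L M a b) = f a \<sqinter>\<^bsub>Z\<^esub> g b"
proof (rule Z.eq_if_same_upper_bounds)
  note G = cp_ideal_cp_gen[OF a b]
  show "copair Z f g (cp_gen L M a b) \<in> carrier Z"
    by (rule copair_closed[OF G])
  show "f a \<sqinter>\<^bsub>Z\<^esub> g b \<in> carrier Z"
    using a b sup_hom_closed[OF f] sup_hom_closed[OF g] by simp
  fix z assume z: "z \<in> carrier Z"
  show "copair Z f g (cp_gen L M a b) \<sqsubseteq>\<^bsub>Z\<^esub> z \<longleftrightarrow> f a \<sqinter>\<^bsub>Z\<^esub> g b \<sqsubseteq>\<^bsub>Z\<^esub> z"
    using copair_le_iff[OF G z] cp_gen_subset_iff[OF cp_ideal_le[OF z], of a b]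
      cp_ideal_closed[OF G] a b by auto
qed

lemma copair_inj1:
  assumes "g \<top>\<^bsub>M\<^esub> = \<top>\<^bsub>Z\<^esub>" "a \<in> carrier L"
  shows "copair Z f g (inj1 L M a) = f a"
  unfolding inj1_def
  using assms sup_hom_closed[OF f] by (simp add: copair_cp_gen Z.meet_top)

lemma copair_inj2:
  assumes "f \<top>\<^bsub>L\<^esub> = \<top>\<^bsub>Z\<^esub>" "b \<in> carrier M"
  shows "copair Z f g (inj2 L M b) = g b"
  unfolding inj2_def
  using assms sup_hom_closed[OF g] by (simp add: copair_cp_gen Z.meet_top)

end

locale tensor_quotient = two_frames L M + frame_quotient "tensor L M" \<rho>
  for L :: "'a gorder" and M :: "'b gorder" and \<rho>
begin

interpretation Q: frame Q
  by (rule Q_frame)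

lemma saturation_inj_sup_hom:
  "sup_hom L Q (saturation T \<rho> \<circ> inj1 L M)" "sup_hom M Q (saturation T \<rho> \<circ> inj2 L M)"
  using sup_hom_comp[OF sup_hom_inj1] sup_hom_comp[OF sup_hom_inj2]
    frame_hom_sup_hom[OF saturation_frame_hom] by blast+

lemma saturation_inj_top:
  "saturation T \<rho> (inj1 L M \<top>\<^bsub>L\<^esub>) = \<top>\<^bsub>Q\<^esub>" "saturation T \<rho> (inj2 L M \<top>\<^bsub>M\<^esub>) = \<top>\<^bsub>Q\<^esub>"
  unfolding inj1_def inj2_def
  by (simp_all add: cp_gen_top frame_hom_top[OF saturation_frame_hom])

text \<open>The definition of \<open>kernel_pair\<close> pairs the two pullback projections. Both
  this pairing and the saturation map send a rectangle to the same element, and every ideal is the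
  join of its rectangles, so the pairing is the quotient map itself.\<close>

lemma copair_saturation:
  assumes U: "cp_ideal L M U"
  shows "copair Q (saturation T \<rho> \<circ> inj1 L M) (saturation T \<rho> \<circ> inj2 L M) U = saturation T \<rho> U"
proof -
  interpret pair: sup_hom_pair L M Q "saturation T \<rho> \<circ> inj1 L M" "saturation T \<rho> \<circ> inj2 L M"
    by (unfold_locales) (rule saturation_inj_sup_hom)+
  have gen: "(saturation T \<rho> \<circ> inj1 L M) a \<sqinter>\<^bsub>Q\<^esub> (saturation T \<rho> \<circ> inj2 L M) b = saturation T \<rho> (cp_gen L M a b)"
    if ab: "a \<in> carrier L" "b \<in> carrier M" for a b
    using frame_hom_meet[OF saturation_frame_hom, of "inj1 L M a" "inj2 L M b"]
      inj1_closed[OF ab(1)] inj2_closed[OF ab(2)] rect_eq_cp_gen[OF ab] by (simp add: rect_def)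
  show ?thesis
  proof (rule Q.eq_if_same_upper_bounds)
    show "copair Q (saturation T \<rho> \<circ> inj1 L M) (saturation T \<rho> \<circ> inj2 L M) U \<in> carrier Q"
      by (rule pair.copair_closed[OF U])
    show "saturation T \<rho> U \<in> carrier Q"
      using saturation_saturated U by simp
    fix z assume z: "z \<in> carrier Q"
    then have zs: "z \<in> saturated T \<rho>" and zi: "cp_ideal L M z"
      using saturated_closed by auto
    have key: "(saturation T \<rho> \<circ> inj1 L M) a \<sqinter>\<^bsub>Q\<^esub> (saturation T \<rho> \<circ> inj2 L M) b \<sqsubseteq>\<^bsub>Q\<^esub> z \<longleftrightarrow> (a, b) \<in> z"
      if ab: "a \<in> carrier L" "b \<in> carrier M" for a b
      unfolding gen[OF ab]
      using saturation_le_iff[OF _ zs, of "cp_gen L M a b"] cp_ideal_cp_gen[OF ab]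
        cp_gen_subset_iff[OF zi] by simp
    have "(\<forall>(a, b)\<in>U. (saturation T \<rho> \<circ> inj1 L M) a \<sqinter>\<^bsub>Q\<^esub> (saturation T \<rho> \<circ> inj2 L M) b \<sqsubseteq>\<^bsub>Q\<^esub> z)
        \<longleftrightarrow> (\<forall>(a, b)\<in>U. (a, b) \<in> z)"
    proof (rule ball_cong[OF HOL.refl])
      fix p assume "p \<in> U"
      then obtain a b where p: "p = (a, b)" "a \<in> carrier L" "b \<in> carrier M"
        using cp_ideal_closed[OF U] by auto
      show "(case p of (a, b) \<Rightarrow> (saturation T \<rho> \<circ> inj1 L M) a \<sqinter>\<^bsub>Q\<^esub> (saturation T \<rho> \<circ> inj2 L M) b \<sqsubseteq>\<^bsub>Q\<^esub> z)
          \<longleftrightarrow> (case p of (a, b) \<Rightarrow> (a, b) \<in> z)"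
        unfolding p(1) prod.case by (rule key[OF p(2,3)])
    qed
    also have "\<dots> \<longleftrightarrow> saturation T \<rho> U \<sqsubseteq>\<^bsub>Q\<^esub> z"
      using saturation_le_iff[OF _ zs, of U] U by auto
    finally show "copair Q (saturation T \<rho> \<circ> inj1 L M) (saturation T \<rho> \<circ> inj2 L M) U \<sqsubseteq>\<^bsub>Q\<^esub> z
        \<longleftrightarrow> saturation T \<rho> U \<sqsubseteq>\<^bsub>Q\<^esub> z"
      using pair.copair_le_iff[OF U z] by simp
  qed
qed

end


section \<open>Open maps\<close>

text \<open>Frobenius reciprocity is given for some left adjoint, while \<open>left_adjoint\<close>
  is a choice constrained by adjointness alone. Uniqueness of adjoints on the carrier carries the
  law over to the chosen one.\<close>

lemma open_map_left_adjoint: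
  assumes L: "frame L" and M: "frame M" and f: "open_map L M f"
  shows "x \<in> carrier M \<Longrightarrow> left_adjoint L M f x \<in> carrier L"
    and "\<lbrakk>x \<in> carrier M; y \<in> carrier L\<rbrakk>
      \<Longrightarrow> left_adjoint L M f x \<sqsubseteq>\<^bsub>L\<^esub> y \<longleftrightarrow> x \<sqsubseteq>\<^bsub>M\<^esub> f y"
    and "\<lbrakk>x \<in> carrier M; y \<in> carrier L\<rbrakk>
      \<Longrightarrow> left_adjoint L M f (x \<sqinter>\<^bsub>M\<^esub> f y) = left_adjoint L M f x \<sqinter>\<^bsub>L\<^esub> y"
    and "sup_hom M L (left_adjoint L M f)"
proof -
  interpret L: frame L by (rule L)
  interpret M: frame M by (rule M)
  let ?l = "left_adjoint L M f"
  obtain g where g: "is_left_adjoint L M f g"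
    and frob: "\<And>x y. \<lbrakk>x \<in> carrier M; y \<in> carrier L\<rbrakk> \<Longrightarrow> g (x \<sqinter>\<^bsub>M\<^esub> f y) = g x \<sqinter>\<^bsub>L\<^esub> y"
    using f unfolding open_map_def by blast
  have f_hom: "frame_hom L M f"
    using f unfolding open_map_def by blast
  have adj: "h x \<in> carrier L" "y \<in> carrier L \<Longrightarrow> h x \<sqsubseteq>\<^bsub>L\<^esub> y \<longleftrightarrow> x \<sqsubseteq>\<^bsub>M\<^esub> f y"
    if "is_left_adjoint L M f h" "x \<in> carrier M" for h x y
    using that connection.lower_closed[of "\<lparr>orderA = M, orderB = L, lower = h, upper = f\<rparr>" x]
      galois_connection.galois_property[of "\<lparr>orderA = M, orderB = L, lower = h, upper = f\<rparr>" x y]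
    unfolding is_left_adjoint_def galois_connection_def by auto
  have l: "is_left_adjoint L M f ?l"
    unfolding left_adjoint_def by (rule someI[of "is_left_adjoint L M f", OF g])
  show closed: "?l x \<in> carrier L" if "x \<in> carrier M" for x
    using adj(1)[OF l that] .
  show le_iff: "?l x \<sqsubseteq>\<^bsub>L\<^esub> y \<longleftrightarrow> x \<sqsubseteq>\<^bsub>M\<^esub> f y" if "x \<in> carrier M" "y \<in> carrier L" for x y
    using adj(2)[OF l that] .
  have eq: "?l x = g x" if "x \<in> carrier M" for x
    using adj(1)[OF l that] adj(1)[OF g that] adj(2)[OF l that] adj(2)[OF g that]
    by (intro L.eq_if_same_upper_bounds) simp_all
  show "?l (x \<sqinter>\<^bsub>M\<^esub> f y) = ?l x \<sqinter>\<^bsub>L\<^esub> y" if "x \<in> carrier M" "y \<in> carrier L" for x y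
    using frob[OF that] eq that frame_hom_closed[OF f_hom] by simp
  show "sup_hom M L ?l"
    unfolding sup_hom_def
  proof (intro conjI allI impI)
    show "?l \<in> carrier M \<rightarrow> carrier L" using closed by blast
    fix A assume A: "A \<subseteq> carrier M"
    have "\<Squnion>\<^bsub>L\<^esub> (?l ` A) = ?l (\<Squnion>\<^bsub>M\<^esub> A)"
    proof (rule L.sup_eqI)
      fix z assume z: "z \<in> carrier L"
      have "?l (\<Squnion>\<^bsub>M\<^esub> A) \<sqsubseteq>\<^bsub>L\<^esub> z \<longleftrightarrow> (\<forall>a\<in>A. a \<sqsubseteq>\<^bsub>M\<^esub> f z)"
        using A z le_iff frame_hom_closed[OF f_hom] by (simp add: M.sup_le_iff)
      also have "\<dots> \<longleftrightarrow> (\<forall>a\<in>?l ` A. a \<sqsubseteq>\<^bsub>L\<^esub> z)"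
        using A z le_iff by (simp add: subset_iff)
      finally show "?l (\<Squnion>\<^bsub>M\<^esub> A) \<sqsubseteq>\<^bsub>L\<^esub> z \<longleftrightarrow> (\<forall>a\<in>?l ` A. a \<sqsubseteq>\<^bsub>L\<^esub> z)" .
    qed (use A closed in auto)
    then show "?l (\<Squnion>\<^bsub>M\<^esub> A) = \<Squnion>\<^bsub>L\<^esub> (?l ` A)" ..
  qed
qed


section \<open>Equivalence relations with open cones\<close>

lemma ball_rect_rel:
  "(\<forall>(p, q)\<in>rect_rel X u d. P p q) \<longleftrightarrow>
    (\<forall>a\<in>carrier X. \<forall>b\<in>carrier X. \<forall>a'\<in>carrier X. \<forall>b'\<in>carrier X.
      u a \<sqinter>\<^bsub>X\<^esub> b = u a' \<sqinter>\<^bsub>X\<^esub> b' \<and> a \<sqinter>\<^bsub>X\<^esub> d b = a' \<sqinter>\<^bsub>X\<^esub> d b' \<longrightarrow>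
      P (rect X X a b) (rect X X a' b'))"
proof
  assume P: "\<forall>(p, q)\<in>rect_rel X u d. P p q"
  have "P (rect X X a b) (rect X X a' b')" if "(rect X X a b, rect X X a' b') \<in> rect_rel X u d" for a b a' b'
    using bspec[OF P that] by simp
  then show "\<forall>a\<in>carrier X. \<forall>b\<in>carrier X. \<forall>a'\<in>carrier X. \<forall>b'\<in>carrier X.
      u a \<sqinter>\<^bsub>X\<^esub> b = u a' \<sqinter>\<^bsub>X\<^esub> b' \<and> a \<sqinter>\<^bsub>X\<^esub> d b = a' \<sqinter>\<^bsub>X\<^esub> d b' \<longrightarrow>
      P (rect X X a b) (rect X X a' b')"
    unfolding rect_rel_def by blast
qed (auto simp: rect_rel_def)

locale open_equivalence = X: frame X for X :: "'a gorder" +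
  fixes R :: "('a, 'r) localic_relation"
  assumes equivalence: "is_equivalence_relation X R"
    and open_cones: "has_open_cones X R"
begin

section \<open>Source, target and cones; symmetry and reflexivity\<close>

abbreviation "s \<equiv> source X R"
abbreviation "t \<equiv> target X R"
abbreviation "cone \<equiv> up_cone X R"

sublocale XX: two_frames X X
  by unfold_locales

sublocale R: frame "fst R"
  using equivalence
  unfolding is_equivalence_relation_def is_localic_relation_def is_sublocale_def by blast

sublocale RR: two_frames "fst R" "fst R"
  by unfold_locales

lemma R_frame_hom: "frame_hom (tensor X X) (fst R) (snd R)"
  using equivalence
  unfolding is_equivalence_relation_def is_localic_relation_def is_sublocale_def by blast

lemma s_open: "open_map X (fst R) s" and t_open: "open_map X (fst R) t"
  using open_cones unfolding has_open_cones_def by auto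

lemma s_hom: "frame_hom X (fst R) s" and t_hom: "frame_hom X (fst R) t"
  using s_open t_open unfolding open_map_def by auto

lemmas s_closed = frame_hom_closed[OF s_hom] and t_closed = frame_hom_closed[OF t_hom]

lemmas t_left_adjoint =
  open_map_left_adjoint[OF X.frame_axioms R.frame_axioms t_open]

lemmas s_left_adjoint =
  open_map_left_adjoint[OF X.frame_axioms R.frame_axioms s_open]

lemma cone_closed: "a \<in> carrier X \<Longrightarrow> cone a \<in> carrier X"
  unfolding up_cone_def by (simp add: t_left_adjoint(1) s_closed)

lemma cone_le_iff:
  "\<lbrakk>a \<in> carrier X; b \<in> carrier X\<rbrakk> \<Longrightarrow> cone a \<sqsubseteq>\<^bsub>X\<^esub> b \<longleftrightarrow> s a \<sqsubseteq>\<^bsub>fst R\<^esub> t b"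
  unfolding up_cone_def by (simp add: t_left_adjoint(2) s_closed)

text \<open>The isomorphism of \<open>R\<close> with its opposite, evaluated at the coproduct
  injections, exchanges the source and target frame maps.\<close>

lemma swap_hom:
  obtains h where "frame_hom (fst R) (fst R) h"
    and "\<And>a. a \<in> carrier X \<Longrightarrow> h (s a) = t a" "\<And>a. a \<in> carrier X \<Longrightarrow> h (t a) = s a"
proof -
  obtain h where h: "frame_hom (fst R) (fst R) h"
    and hw: "\<And>w. w \<in> carrier (tensor X X) \<Longrightarrow> h (copair (fst R) t s w) = snd R w"
    using equivalence
    unfolding is_equivalence_relation_def subloc_iso_def opposite_def by auto
  interpret pair: sup_hom_pair X X "fst R" t s
    by unfold_locales (simp_all add: frame_hom_sup_hom s_hom t_hom)
  show thesis
  proof (rule that[OF h])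
    fix a assume a: "a \<in> carrier X"
    show "h (s a) = t a"
      using hw[of "inj2 X X a"] pair.copair_inj2[OF frame_hom_top[OF t_hom] a] XX.inj2_closed[OF a]
      by (simp add: target_def)
    show "h (t a) = s a"
      using hw[of "inj1 X X a"] pair.copair_inj1[OF frame_hom_top[OF s_hom] a] XX.inj1_closed[OF a]
      by (simp add: source_def)
  qed
qed

text \<open>The swap is monotone and turns each of the two inequalities into the other.\<close>

lemma s_le_t_iff:
  assumes a: "a \<in> carrier X" and b: "b \<in> carrier X"
  shows "s a \<sqsubseteq>\<^bsub>fst R\<^esub> t b \<longleftrightarrow> t a \<sqsubseteq>\<^bsub>fst R\<^esub> s b"
proof -
  obtain h where h: "frame_hom (fst R) (fst R) h"
    and hs: "\<And>a. a \<in> carrier X \<Longrightarrow> h (s a) = t a" and ht: "\<And>a. a \<in> carrier X \<Longrightarrow> h (t a) = s a"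
    using swap_hom by blast
  note mono = frame_hom_mono[OF R.frame_axioms R.frame_axioms h]
  show ?thesis
    using mono[of "s a" "t b"] mono[of "t a" "s b"] a b
    by (auto simp: hs ht s_closed t_closed)
qed

lemma down_cone_eq:
  assumes a: "a \<in> carrier X"
  shows "down_cone X R a = cone a"
proof (rule X.eq_if_same_upper_bounds)
  show "down_cone X R a \<in> carrier X"
    unfolding down_cone_def using a by (simp add: s_left_adjoint(1) t_closed)
  fix b assume "b \<in> carrier X"
  then show "down_cone X R a \<sqsubseteq>\<^bsub>X\<^esub> b \<longleftrightarrow> cone a \<sqsubseteq>\<^bsub>X\<^esub> b"
    using a s_le_t_iff[of a b] cone_le_iff[of a b] s_left_adjoint(2)[of "t a" b]
    by (simp add: down_cone_def t_closed)
qed (use a cone_closed in simp)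

text \<open>Reflexivity supplies a frame map restricting opens of \<open>R\<close> to the diagonal.
  It is a common retraction of \<open>s\<close> and \<open>t\<close>, so applying it to the
  inequality leaves \<open>a\<close> and \<open>b\<close>.\<close>

lemma s_le_t_imp_le:
  assumes a: "a \<in> carrier X" and b: "b \<in> carrier X" and le: "s a \<sqsubseteq>\<^bsub>fst R\<^esub> t b"
  shows "a \<sqsubseteq>\<^bsub>X\<^esub> b"
proof -
  obtain h where h: "frame_hom (fst R) X h"
    and hw: "\<And>w. w \<in> carrier (tensor X X) \<Longrightarrow> h (snd R w) = copair X (\<lambda>u. u) (\<lambda>u. u) w"
    using equivalence
    unfolding is_equivalence_relation_def subloc_le_def diagonal_def by auto
  interpret pair: sup_hom_pair X X X "\<lambda>u. u" "\<lambda>u. u"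
    by unfold_locales (simp_all add: sup_hom_def)
  have "h (s a) = a" "h (t b) = b"
    using hw[of "inj1 X X a"] hw[of "inj2 X X b"] pair.copair_inj1[OF refl a] pair.copair_inj2[OF refl b]
      XX.inj1_closed[OF a] XX.inj2_closed[OF b] by (simp_all add: source_def target_def)
  then show ?thesis
    using frame_hom_mono[OF R.frame_axioms X.frame_axioms h _ _ le] a b by (simp add: s_closed t_closed)
qed

text \<open>The unit of the adjunction between \<open>t_!\<close> and \<open>t\<close> gives
  \<open>s a \<sqsubseteq> t (cone a)\<close>, and reflexivity strips off \<open>s\<close> and
  \<open>t\<close>.\<close>

lemma le_cone: "a \<in> carrier X \<Longrightarrow> a \<sqsubseteq>\<^bsub>X\<^esub> cone a"
  using s_le_t_imp_le[of a "cone a"] cone_le_iff[of a "cone a"] cone_closed[of a] by simp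

text \<open>The Beck--Chevalley argument: the elements \<open>(x, y)\<close> with
  \<open>s (t\<^sub>! x) \<sqinter> y \<sqsubseteq> t b\<close> form a saturated element of the pullback, by Frobenius
  reciprocity for \<open>t\<close>. It contains the pulled back \<open>t b\<close>, hence by transitivity \<open>s a\<close>.\<close>

lemma s_cone_le_t:
  assumes a: "a \<in> carrier X" and b: "b \<in> carrier X" and le: "s a \<sqsubseteq>\<^bsub>fst R\<^esub> t b"
  shows "s (cone a) \<sqsubseteq>\<^bsub>fst R\<^esub> t b"
proof -
  define \<rho> where "\<rho> = {(inj1 (fst R) (fst R) (t u), inj2 (fst R) (fst R) (s u)) | u. u \<in> carrier X}"
  let ?T = "tensor (fst R) (fst R)" and ?l = "left_adjoint X (fst R) t"
  interpret TRR: frame ?T by (rule RR.tensor_frame)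
  interpret P: tensor_quotient "fst R" "fst R" \<rho>
    by unfold_locales (auto simp: \<rho>_def RR.inj1_closed RR.inj2_closed s_closed t_closed)
  interpret Q: frame P.Q by (rule P.Q_frame)
  let ?p1 = "saturation ?T \<rho> \<circ> inj1 (fst R) (fst R)" and ?p2 = "saturation ?T \<rho> \<circ> inj2 (fst R) (fst R)"
  interpret C: sup_hom_pair X X P.Q "?p1 \<circ> s" "?p2 \<circ> t"
    by unfold_locales
      (rule sup_hom_comp[OF frame_hom_sup_hom P.saturation_inj_sup_hom(1), OF s_hom]
        sup_hom_comp[OF frame_hom_sup_hom P.saturation_inj_sup_hom(2), OF t_hom])+
  have composite: "self_composite X R =
      image_subloc (tensor X X) P.Q (copair P.Q (?p1 \<circ> s) (?p2 \<circ> t))"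
    unfolding self_composite_def Let_def pullback_pr1_def pullback_pr2_def pullback_def
      quot_subloc_def fst_conv snd_conv \<rho>_def ..
  obtain h where hw: "\<And>w. w \<in> carrier (tensor X X) \<Longrightarrow> h (snd R w) = copair P.Q (?p1 \<circ> s) (?p2 \<circ> t) w"
    using equivalence
    unfolding is_equivalence_relation_def subloc_le_def composite image_subloc_def by auto
  let ?i = "inj1 X X a" and ?j = "inj2 X X b"
  interpret TXX: frame "tensor X X" by (rule XX.tensor_frame)
  have ij: "?i \<in> carrier (tensor X X)" "?j \<in> carrier (tensor X X)"
    using XX.inj1_closed[OF a] XX.inj2_closed[OF b] by simp_all
  \<comment> \<open>The inequality \<open>s a \<sqsubseteq> t b\<close> is recast as an equation
    between the values of \<open>snd R\<close> at \<open>?i \<sqinter> ?j\<close> and at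
    \<open>?i\<close>. Since the map of the composite factors through \<open>snd R\<close>, its
    values there are equal as well.\<close>
  have "snd R (?i \<sqinter>\<^bsub>tensor X X\<^esub> ?j) = s a \<sqinter>\<^bsub>fst R\<^esub> t b"
    using frame_hom_meet[OF R_frame_hom ij] by (simp add: source_def target_def)
  also have "\<dots> = snd R ?i"
    using R.meet_eq_left[OF _ _ le] a b by (simp add: s_closed t_closed) (simp add: source_def)
  finally have eq: "copair P.Q (?p1 \<circ> s) (?p2 \<circ> t) ?i =
      copair P.Q (?p1 \<circ> s) (?p2 \<circ> t) (?i \<sqinter>\<^bsub>tensor X X\<^esub> ?j)"
    using hw[OF ij(1)] hw[OF TXX.meet_closed[OF ij]] by simp
  have "copair P.Q (?p1 \<circ> s) (?p2 \<circ> t) (?i \<sqinter>\<^bsub>tensor X X\<^esub> ?j)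
      \<sqsubseteq>\<^bsub>P.Q\<^esub> copair P.Q (?p1 \<circ> s) (?p2 \<circ> t) ?j"
    using ij TXX.meet_closed[OF ij] TXX.meet_right[OF ij] by (intro C.copair_mono) simp_all
  then have "copair P.Q (?p1 \<circ> s) (?p2 \<circ> t) ?i \<subseteq> copair P.Q (?p1 \<circ> s) (?p2 \<circ> t) ?j"
    unfolding eq by simp
  moreover have "copair P.Q (?p1 \<circ> s) (?p2 \<circ> t) ?i = ?p1 (s a)"
    using C.copair_inj1[OF _ a] frame_hom_top[OF t_hom] P.saturation_inj_top by simp
  moreover have "copair P.Q (?p1 \<circ> s) (?p2 \<circ> t) ?j = ?p2 (t b)"
    using C.copair_inj2[OF _ b] frame_hom_top[OF s_hom] P.saturation_inj_top by simp
  \<comment> \<open>On the pullback, \<open>s a\<close> pulled back along the first projection lies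
    below \<open>t b\<close> pulled back along the second. It remains to push this forward along the
    second projection; the ideal \<open>?O\<close> does this without constructing that left
    adjoint.\<close>
  ultimately have sub: "?p1 (s a) \<subseteq> ?p2 (t b)" by simp

  interpret B: sup_hom_pair "fst R" "fst R" "fst R" "s \<circ> ?l" "\<lambda>y. y"
    by unfold_locales
      (rule sup_hom_comp[OF t_left_adjoint(4) frame_hom_sup_hom[OF s_hom]], simp add: sup_hom_def)
  let ?O = "{(x, y) \<in> carrier (fst R) \<times> carrier (fst R). (s \<circ> ?l) x \<sqinter>\<^bsub>fst R\<^esub> y \<sqsubseteq>\<^bsub>fst R\<^esub> t b}"
  have O: "cp_ideal (fst R) (fst R) ?O"
    by (rule B.cp_ideal_le) (rule t_closed[OF b])
  \<comment> \<open>Frobenius pulls \<open>u\<close> out of \<open>t_!\<close>, and \<open>s\<close>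
    preserves the resulting meet: this is exactly the exchange of \<open>t u\<close> on the left for
    \<open>s u\<close> on the right that saturation demands.\<close>
  have "s (?l (t u \<sqinter>\<^bsub>fst R\<^esub> x)) \<sqinter>\<^bsub>fst R\<^esub> y = s (?l x) \<sqinter>\<^bsub>fst R\<^esub> (s u \<sqinter>\<^bsub>fst R\<^esub> y)"
    if u: "u \<in> carrier X" and x: "x \<in> carrier (fst R)" and y: "y \<in> carrier (fst R)" for u x y
  proof -
    have "?l (t u \<sqinter>\<^bsub>fst R\<^esub> x) = ?l x \<sqinter>\<^bsub>X\<^esub> u"
      using t_left_adjoint(3)[OF x u] meet_comm[of "fst R" "t u" x] by simp
    then have "s (?l (t u \<sqinter>\<^bsub>fst R\<^esub> x)) = s (?l x) \<sqinter>\<^bsub>fst R\<^esub> s u"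
      using frame_hom_meet[OF s_hom t_left_adjoint(1)[OF x] u] by simp
    then show ?thesis
      using R.meet_assoc[of "s (?l x)" "s u" y] u x y by (simp add: s_closed t_left_adjoint(1))
  qed
  then have sat: "?O \<in> saturated ?T \<rho>"
    unfolding \<rho>_def using O by (subst RR.pushout_saturated_iff) (auto simp: s_closed t_closed)
  have "(\<top>\<^bsub>fst R\<^esub>, t b) \<in> ?O"
    using R.meet_right[of "s (?l \<top>\<^bsub>fst R\<^esub>)" "t b"] b by (simp add: t_closed s_closed t_left_adjoint(1))
  then have "inj2 (fst R) (fst R) (t b) \<subseteq> ?O"
    unfolding inj2_def by (simp only: RR.cp_gen_subset_iff[OF O])
  then have "?p2 (t b) \<subseteq> ?O"
    using P.saturation_le_iff[OF _ sat, of "inj2 (fst R) (fst R) (t b)"] RR.inj2_closed[OF t_closed[OF b]]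
    by simp
  moreover have "inj1 (fst R) (fst R) (s a) \<subseteq> ?p1 (s a)"
    using P.saturation_upper[of "inj1 (fst R) (fst R) (s a)"] RR.inj1_closed[OF s_closed[OF a]] by simp
  ultimately have "inj1 (fst R) (fst R) (s a) \<subseteq> ?O"
    using sub by (meson order_trans)
  \<comment> \<open>Membership of this pair unfolds to the claim, since \<open>cone a\<close> is
    \<open>t_!\<close> applied to \<open>s a\<close>.\<close>
  then have "(s a, \<top>\<^bsub>fst R\<^esub>) \<in> ?O"
    unfolding inj1_def by (simp only: RR.cp_gen_subset_iff[OF O])
  then show ?thesis
    using a by (simp add: up_cone_def R.meet_top s_closed t_left_adjoint(1))
qed

text \<open>One inequality is the transitivity lemma with \<open>b\<close> chosen as
  \<open>cone a\<close>; symmetry reverses it.\<close>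

lemma s_cone_eq_t_cone:
  assumes a: "a \<in> carrier X"
  shows "s (cone a) = t (cone a)"
proof (rule R.le_antisym)
  note c = cone_closed[OF a]
  show "s (cone a) \<sqsubseteq>\<^bsub>fst R\<^esub> t (cone a)"
    using s_cone_le_t[OF a c] cone_le_iff[OF a c] c by simp
  then show "t (cone a) \<sqsubseteq>\<^bsub>fst R\<^esub> s (cone a)"
    using s_le_t_iff[OF c c] by simp
qed (use cone_closed[OF a] in \<open>simp_all add: s_closed t_closed\<close>)

lemma cone_fixed:
  assumes u: "u \<in> carrier X" and eq: "s u = t u"
  shows "cone u = u"
proof (rule X.le_antisym)
  show "cone u \<sqsubseteq>\<^bsub>X\<^esub> u"
    using cone_le_iff[OF u u] eq u by (simp add: t_closed)
qed (use le_cone[OF u] cone_closed[OF u] u in simp_all)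

lemma cone_top: "cone \<top>\<^bsub>X\<^esub> = \<top>\<^bsub>X\<^esub>"
  using frame_hom_top[OF s_hom] frame_hom_top[OF t_hom] by (intro cone_fixed) simp_all

section \<open>Comparison of the two generating relations\<close>

definition "invariant = {u \<in> carrier X. s u = t u}"

text \<open>This is the relation that \<open>pullback\<close> uses for the quotient map:
  \<open>invariant\<close> is the carrier of \<open>quotient_locale X R\<close>, and
  \<open>coequaliser_map\<close> is the inclusion.\<close>

definition "kernel_rel = {(inj1 X X u, inj2 X X u) | u. u \<in> invariant}"

abbreviation "cone_rel \<equiv> rect_rel X cone (down_cone X R)"

lemma kernel_saturated_iff:
  "U \<in> saturated (tensor X X) kernel_rel \<longleftrightarrow> cp_ideal X X U \<and>
    (\<forall>u\<in>invariant. \<forall>x\<in>carrier X. \<forall>y\<in>carrier X.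
      (u \<sqinter>\<^bsub>X\<^esub> x, y) \<in> U \<longleftrightarrow> (x, u \<sqinter>\<^bsub>X\<^esub> y) \<in> U)"
  unfolding kernel_rel_def
  by (rule XX.pushout_saturated_iff) (simp_all add: invariant_def)

lemma kernel_saturated_mem_iff:
  assumes U: "U \<in> saturated (tensor X X) kernel_rel"
    and c: "a \<in> carrier X" "b \<in> carrier X" "x \<in> carrier X" "y \<in> carrier X"
  shows "(a \<sqinter>\<^bsub>X\<^esub> x, b \<sqinter>\<^bsub>X\<^esub> y) \<in> U \<longleftrightarrow>
    ((a \<sqinter>\<^bsub>X\<^esub> cone b) \<sqinter>\<^bsub>X\<^esub> x, (cone a \<sqinter>\<^bsub>X\<^esub> b) \<sqinter>\<^bsub>X\<^esub> y) \<in> U"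
proof -
  have move: "(u \<sqinter>\<^bsub>X\<^esub> x, y) \<in> U \<longleftrightarrow> (x, u \<sqinter>\<^bsub>X\<^esub> y) \<in> U"
    if "u \<in> invariant" "x \<in> carrier X" "y \<in> carrier X" for u x y
    using U that unfolding kernel_saturated_iff by simp
  have inv: "cone a \<in> invariant" "cone b \<in> invariant"
    using c cone_closed s_cone_eq_t_cone by (simp_all add: invariant_def)
  note cc = cone_closed[OF c(1)] cone_closed[OF c(2)]
  \<comment> \<open>Because \<open>v\<close> lies below \<open>cone v\<close>, a meet with
    \<open>cone v\<close> may be inserted next to \<open>v\<close> at no cost. Being invariant, it
    can then be moved to the other component; this is done once with \<open>a\<close> and once with
    \<open>b\<close>.\<close>
  have absorb: "cone v \<sqinter>\<^bsub>X\<^esub> (v \<sqinter>\<^bsub>X\<^esub> w) = v \<sqinter>\<^bsub>X\<^esub> w" if v: "v \<in> carrier X" and w: "w \<in> carrier X" for v w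
    using X.meet_assoc[of "cone v" v w] X.meet_eq_left[OF v cone_closed[OF v] le_cone[OF v]]
      meet_comm[of X "cone v" v] v w cone_closed[OF v] by simp
  have "(a \<sqinter>\<^bsub>X\<^esub> x, b \<sqinter>\<^bsub>X\<^esub> y) \<in> U \<longleftrightarrow> (a \<sqinter>\<^bsub>X\<^esub> x, cone a \<sqinter>\<^bsub>X\<^esub> (b \<sqinter>\<^bsub>X\<^esub> y)) \<in> U"
    using move[OF inv(1), of "a \<sqinter>\<^bsub>X\<^esub> x" "b \<sqinter>\<^bsub>X\<^esub> y"] absorb[of a x] c by simp
  also have "cone a \<sqinter>\<^bsub>X\<^esub> (b \<sqinter>\<^bsub>X\<^esub> y) = b \<sqinter>\<^bsub>X\<^esub> (cone a \<sqinter>\<^bsub>X\<^esub> y)"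
    using X.meet_assoc[of "cone a" b y] X.meet_assoc[of b "cone a" y] meet_comm[of X b "cone a"] c cc
    by simp
  also have "(a \<sqinter>\<^bsub>X\<^esub> x, b \<sqinter>\<^bsub>X\<^esub> (cone a \<sqinter>\<^bsub>X\<^esub> y)) \<in> U \<longleftrightarrow>
      (cone b \<sqinter>\<^bsub>X\<^esub> (a \<sqinter>\<^bsub>X\<^esub> x), b \<sqinter>\<^bsub>X\<^esub> (cone a \<sqinter>\<^bsub>X\<^esub> y)) \<in> U"
    using move[OF inv(2), of "a \<sqinter>\<^bsub>X\<^esub> x" "b \<sqinter>\<^bsub>X\<^esub> (cone a \<sqinter>\<^bsub>X\<^esub> y)"] absorb[of b "cone a \<sqinter>\<^bsub>X\<^esub> y"] c cc
    by simp
  also have "cone b \<sqinter>\<^bsub>X\<^esub> (a \<sqinter>\<^bsub>X\<^esub> x) = (a \<sqinter>\<^bsub>X\<^esub> cone b) \<sqinter>\<^bsub>X\<^esub> x"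
    using X.meet_assoc[of "cone b" a x] meet_comm[of X a "cone b"] c cc by simp
  also have "b \<sqinter>\<^bsub>X\<^esub> (cone a \<sqinter>\<^bsub>X\<^esub> y) = (cone a \<sqinter>\<^bsub>X\<^esub> b) \<sqinter>\<^bsub>X\<^esub> y"
    using X.meet_assoc[of b "cone a" y] meet_comm[of X "cone a" b] c cc by simp
  finally show ?thesis .
qed

text \<open>The relation on rectangles becomes a condition on pairs: the down cone is replaced by
  the up cone, and the test elements by rectangles on \<open>(x, y)\<close>.\<close>

lemma cone_rel_saturated_iff:
  "U \<in> saturated (tensor X X) cone_rel \<longleftrightarrow> cp_ideal X X U \<and>
    (\<forall>a\<in>carrier X. \<forall>b\<in>carrier X. \<forall>c\<in>carrier X. \<forall>d\<in>carrier X.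
      cone a \<sqinter>\<^bsub>X\<^esub> b = cone c \<sqinter>\<^bsub>X\<^esub> d \<and> a \<sqinter>\<^bsub>X\<^esub> cone b = c \<sqinter>\<^bsub>X\<^esub> cone d \<longrightarrow>
      (\<forall>x\<in>carrier X. \<forall>y\<in>carrier X.
        (a \<sqinter>\<^bsub>X\<^esub> x, b \<sqinter>\<^bsub>X\<^esub> y) \<in> U \<longleftrightarrow> (c \<sqinter>\<^bsub>X\<^esub> x, d \<sqinter>\<^bsub>X\<^esub> y) \<in> U))"
proof (cases "cp_ideal X X U")
  case True
  let ?sat = "\<lambda>p q. \<forall>W\<in>carrier (tensor X X).
    p \<sqinter>\<^bsub>tensor X X\<^esub> W \<sqsubseteq>\<^bsub>tensor X X\<^esub> U \<longleftrightarrow> q \<sqinter>\<^bsub>tensor X X\<^esub> W \<sqsubseteq>\<^bsub>tensor X X\<^esub> U"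
  have "U \<in> saturated (tensor X X) cone_rel \<longleftrightarrow> (\<forall>(p, q)\<in>cone_rel. ?sat p q)"
    using True unfolding saturated_def by simp
  also have "\<dots> \<longleftrightarrow> (\<forall>a\<in>carrier X. \<forall>b\<in>carrier X. \<forall>c\<in>carrier X. \<forall>d\<in>carrier X.
      cone a \<sqinter>\<^bsub>X\<^esub> b = cone c \<sqinter>\<^bsub>X\<^esub> d \<and> a \<sqinter>\<^bsub>X\<^esub> down_cone X R b = c \<sqinter>\<^bsub>X\<^esub> down_cone X R d \<longrightarrow>
      ?sat (rect X X a b) (rect X X c d))"
    by (rule ball_rect_rel)
  also have "\<dots> \<longleftrightarrow> (\<forall>a\<in>carrier X. \<forall>b\<in>carrier X. \<forall>c\<in>carrier X. \<forall>d\<in>carrier X.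
      cone a \<sqinter>\<^bsub>X\<^esub> b = cone c \<sqinter>\<^bsub>X\<^esub> d \<and> a \<sqinter>\<^bsub>X\<^esub> cone b = c \<sqinter>\<^bsub>X\<^esub> cone d \<longrightarrow>
      (\<forall>x\<in>carrier X. \<forall>y\<in>carrier X.
        (a \<sqinter>\<^bsub>X\<^esub> x, b \<sqinter>\<^bsub>X\<^esub> y) \<in> U \<longleftrightarrow> (c \<sqinter>\<^bsub>X\<^esub> x, d \<sqinter>\<^bsub>X\<^esub> y) \<in> U))"
    using True by (simp only: XX.rect_eq_cp_gen down_cone_eq XX.cp_gen_pair_saturated_iff cong: ball_cong)
  finally show ?thesis using True by simp
qed (simp add: saturated_def)

lemma saturated_eq:
  "saturated (tensor X X) cone_rel = saturated (tensor X X) kernel_rel"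
proof (intro equalityI subsetI)
  fix U assume U: "U \<in> saturated (tensor X X) kernel_rel"
  show "U \<in> saturated (tensor X X) cone_rel"
    unfolding cone_rel_saturated_iff
  proof (intro conjI ballI impI)
    show "cp_ideal X X U"
      using U unfolding kernel_saturated_iff by simp
    fix a b c d x y
    assume c: "a \<in> carrier X" "b \<in> carrier X" "c \<in> carrier X" "d \<in> carrier X"
        "x \<in> carrier X" "y \<in> carrier X"
      and "cone a \<sqinter>\<^bsub>X\<^esub> b = cone c \<sqinter>\<^bsub>X\<^esub> d \<and> a \<sqinter>\<^bsub>X\<^esub> cone b = c \<sqinter>\<^bsub>X\<^esub> cone d"
    \<comment> \<open>Both memberships are brought to the same normal form, in which only the two
      elements assumed equal occur.\<close>
    then show "(a \<sqinter>\<^bsub>X\<^esub> x, b \<sqinter>\<^bsub>X\<^esub> y) \<in> U \<longleftrightarrow> (c \<sqinter>\<^bsub>X\<^esub> x, d \<sqinter>\<^bsub>X\<^esub> y) \<in> U"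
      using kernel_saturated_mem_iff[OF U c(1,2,5,6)] kernel_saturated_mem_iff[OF U c(3-6)] by simp
  qed
next
  fix U assume U: "U \<in> saturated (tensor X X) cone_rel"
  show "U \<in> saturated (tensor X X) kernel_rel"
    unfolding kernel_saturated_iff
  proof (intro conjI ballI)
    show "cp_ideal X X U"
      using U unfolding cone_rel_saturated_iff by simp
    fix u x y assume "u \<in> invariant" and xy: "x \<in> carrier X" "y \<in> carrier X"
    then have u: "u \<in> carrier X" "cone u = u"
      using cone_fixed by (simp_all add: invariant_def)
    note top = X.top_closed
    \<comment> \<open>The rectangles on \<open>(u, \<top>)\<close> and \<open>(\<top>, u)\<close>
      are related, because \<open>cone\<close> fixes both \<open>u\<close> and
      \<open>\<top>\<close>, so that all four meets in question equal \<open>u\<close>.\<close>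
    have "(u \<sqinter>\<^bsub>X\<^esub> x, \<top>\<^bsub>X\<^esub> \<sqinter>\<^bsub>X\<^esub> y) \<in> U \<longleftrightarrow> (\<top>\<^bsub>X\<^esub> \<sqinter>\<^bsub>X\<^esub> x, u \<sqinter>\<^bsub>X\<^esub> y) \<in> U"
      using conjunct2[OF U[unfolded cone_rel_saturated_iff], rule_format, OF u(1) top top u(1) _ xy]
        u xy by (simp add: cone_top X.meet_top)
    then show "(u \<sqinter>\<^bsub>X\<^esub> x, y) \<in> U \<longleftrightarrow> (x, u \<sqinter>\<^bsub>X\<^esub> y) \<in> U"
      using xy by (simp add: X.meet_top)
  qed
qed

end

section \<open>The induced relation and the kernel pair\<close>

theorem proposition9p9:
  fixes X :: "'a gorder" and R :: "('a, 'r) localic_relation"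
  assumes "frame X"
    and "is_equivalence_relation X R"
    and "has_open_cones X R"
  shows "is_sublocale (tensor X X) (induced_relation X (up_cone X R) (down_cone X R)) \<and>
    is_sublocale (tensor X X) (kernel_pair (quotient_locale X R) X coequaliser_map) \<and>
    subloc_iso (tensor X X)
      (induced_relation X (up_cone X R) (down_cone X R))
      (kernel_pair (quotient_locale X R) X coequaliser_map)"
proof -
  interpret open_equivalence X R
    using assms by (simp add: open_equivalence_def open_equivalence_axioms_def)
  let ?T = "tensor X X" and ?K = "kernel_pair (quotient_locale X R) X coequaliser_map"
    and ?I = "induced_relation X (up_cone X R) (down_cone X R)"
  interpret T: frame ?T by (rule XX.tensor_frame)
  interpret I: frame_quotient ?T cone_rel
    by unfold_locales (auto simp: rect_rel_def XX.rect_eq_cp_gen XX.cp_ideal_cp_gen)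
  interpret K: tensor_quotient X X kernel_rel
    by unfold_locales (auto simp: kernel_rel_def invariant_def XX.inj1_closed XX.inj2_closed)
  have pb: "pullback (quotient_locale X R) X X coequaliser_map coequaliser_map = quot_subloc ?T kernel_rel"
    unfolding pullback_def quotient_locale_def coequaliser_def coequaliser_map_def kernel_rel_def
      invariant_def by simp
  have fst_K: "fst ?K = fst (quot_subloc ?T kernel_rel)"
    unfolding kernel_pair_def pb by (simp add: Let_def)
  \<comment> \<open>The two maps are compared on the carrier, where \<open>w\<close> is an ideal and
    hence a join of rectangles.\<close>
  have snd_K: "snd ?K w = snd (quot_subloc ?T kernel_rel) w" if "w \<in> carrier ?T" for w
    unfolding kernel_pair_def pullback_pr1_def pullback_pr2_def pb
    using that K.copair_saturation[of w] by (simp add: Let_def quot_subloc_def)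
  \<comment> \<open>The quotient depends on its generating relation only through the set of
    saturated elements, so equality of those sets makes the two quotients literally equal and the
    identity an isomorphism.\<close>
  have I_eq: "?I = quot_subloc ?T kernel_rel"
    unfolding induced_relation_def quot_subloc_def saturation_def saturated_eq ..
  have I_sub: "is_sublocale ?T ?I"
    unfolding induced_relation_def by (rule I.quot_subloc_is_sublocale)
  have "snd ?K ` carrier ?T = snd ?I ` carrier ?T"
    using snd_K I_eq by (intro image_cong) auto
  then have K_sub: "is_sublocale ?T ?K"
    using I_sub fst_K I_eq snd_K frame_hom_cong[OF T.frame_axioms, of "fst ?I" "snd ?I" "snd ?K"]
    unfolding is_sublocale_def by auto
  have "frame_hom (fst ?K) (fst ?I) (\<lambda>x. x)"
    unfolding fst_K I_eq frame_hom_def by simp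
  moreover have "bij_betw (\<lambda>x. x) (carrier (fst ?K)) (carrier (fst ?I))"
    unfolding fst_K I_eq bij_betw_def by simp
  ultimately have "subloc_iso ?T ?I ?K"
    unfolding subloc_iso_def using snd_K I_eq by (intro exI[of _ "\<lambda>x. x"]) auto
  then show ?thesis
    using I_sub K_sub by simp
qed

end
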